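(* Let $k,m\ge1$ and $\mathbf{y},\mathbf{z}\in\mathbb{Z}_{\ge0}^k$. Then the $m$-generalized Pitman–Stanley polytope $\operatorname{PS}_k^m(\mathbf{y},\mathbf{z})$ is Ehrhart positive.
   Context: For $\mathbf{y},\mathbf{z}\in\mathbb{Z}_{\ge0}^k$ set $\tilde y_i=y_1+\cdots+y_i$ and $\tilde z_i=z_1+\cdots+z_i$ for $i\in[k]$. The $m$-generalized Pitman–Stanley polytope $\operatorname{PS}_k^m(\mathbf{y},\mathbf{z})$ is the set of points $(x_{i,j})_{i\in[k],j\in[m]}\in\mathbb{R}^{km}$ satisfying $\tilde z_i\le x_{i,1}\le x_{i,2}\le\cdots\le x_{i,m}\le\tilde y_i$ for all $i\in[k]$, and $x_{i,j}\le x_{i+1,j}$ for all $i\in[k-1]$, $j\in[m]$. It is a (possibly empty) lattice polytope. A lattice polytope $Q\subset\mathbb{R}^d$ is Ehrhart positive if its Ehrhart polynomial $E_Q(n)=|nQ\cap\mathbb{Z}^d|$ ($n\ge0$) has only nonnegative coefficients. *)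

theory Defs
  imports "HOL-Analysis.Analysis" "HOL-Analysis.Finite_Function_Topology"
    "HOL-Computational_Algebra.Polynomial"
begin

(* R^I, for a finite index set I of elements of 'i, is represented by the real vectors of type
   'i \<Rightarrow>\<^sub>0 real whose keys lie in I. A polytope spans only finitely many coordinates, and
   the count in ehrhart_polynomial below does not depend on the choice of I, so I is left out
   of the general definitions. *)

definition integer_lattice :: "('i \<Rightarrow>\<^sub>0 real) set" where
  "integer_lattice = {x. \<forall>i. Poly_Mapping.lookup x i \<in> \<int>}"

definition lattice_polytope :: "('i \<Rightarrow>\<^sub>0 real) set \<Rightarrow> bool" where
  "lattice_polytope Q \<longleftrightarrow> (\<exists>V. finite V \<and> V \<subseteq> integer_lattice \<and> Q = convex hull V)"

(* The dilate is the image of Q, so for Q = {} the count is 0 also at n = 0, and the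
   Ehrhart polynomial of the empty polytope is the zero polynomial. *)
definition ehrhart_polynomial :: "('i \<Rightarrow>\<^sub>0 real) set \<Rightarrow> real poly \<Rightarrow> bool" where
  "ehrhart_polynomial Q E \<longleftrightarrow>
     (\<forall>n::nat. poly E (real n) = real (card ((\<lambda>x. real n *\<^sub>R x) ` Q \<inter> integer_lattice)))"

(* There is at most one E with ehrhart_polynomial Q E, since E is prescribed at infinitely
   many points. *)
definition ehrhart_positive :: "('i \<Rightarrow>\<^sub>0 real) set \<Rightarrow> bool" where
  "ehrhart_positive Q \<longleftrightarrow>
     lattice_polytope Q \<and> (\<exists>E. ehrhart_polynomial Q E \<and> (\<forall>d. 0 \<le> coeff E d))"

definition partial_sum :: "(nat \<Rightarrow> nat) \<Rightarrow> nat \<Rightarrow> nat" where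
  "partial_sum y i = (\<Sum>l = 1..i. y l)"

(* Only the values of y and z on {1..k} matter. *)
definition pitman_stanley ::
    "nat \<Rightarrow> nat \<Rightarrow> (nat \<Rightarrow> nat) \<Rightarrow> (nat \<Rightarrow> nat) \<Rightarrow> (nat \<times> nat \<Rightarrow>\<^sub>0 real) set" where
  "pitman_stanley k m y z =
     {x. Poly_Mapping.keys x \<subseteq> {1..k} \<times> {1..m} \<and>
         (\<forall>i\<in>{1..k}.
            real (partial_sum z i) \<le> Poly_Mapping.lookup x (i, 1) \<and>
            (\<forall>j\<in>{1..<m}. Poly_Mapping.lookup x (i, j) \<le> Poly_Mapping.lookup x (i, j + 1)) \<and>
            Poly_Mapping.lookup x (i, m) \<le> real (partial_sum y i)) \<and>
         (\<forall>i\<in>{1..<k}. \<forall>j\<in>{1..m}.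
            Poly_Mapping.lookup x (i, j) \<le> Poly_Mapping.lookup x (i + 1, j))}"

end

theory Submission
  imports Defs "Jordan_Normal_Form.Determinant"
begin

text \<open>A lattice point of the dilated polytope is a monotone filling of a rectangle, that is, a chain of
  the partitions formed by the cells with entries below \<open>t\<close>, for increasing \<open>t\<close>. The bounds only
  force some rows to be full or empty at given levels, so the lattice points are counted by sums of
  products of order polynomials of skew shapes, evaluated at the dilation factor. Hence it suffices
  that these order polynomials have nonnegative coefficients. They satisfy
  \<open>\<Omega>\<^bsub>p,q\<^esub>(s + t) = \<Sum>\<nu>. \<Omega>\<^bsub>p,\<nu>\<^esub>(s) \<Omega>\<^bsub>\<nu>,q\<^esub>(t)\<close>. Differentiating at \<open>s = 0\<close> expresses the
  derivative of an order polynomial by order polynomials of smaller shapes with the linear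
  coefficients as weights, so by induction only the linear coefficients matter, and Kreweras'
  determinant gives their sign.\<close>

section \<open>Determinants\<close>

text \<open>Knowing that a polynomial counts chains at natural arguments says nothing about the
  signs of its coefficients; that information enters through the derivative. For this the
  convolution identity is proved for real \<open>s\<close> and natural \<open>t\<close>, so that it
  can be differentiated in \<open>s\<close>. In the result the summand for \<nu> = p drops out,
  because its order polynomial is the constant 1, and every \<nu> not above p contributes 0. What
  remains are strictly smaller intervals of partitions, and the induction closes because it covers
  all skew shapes. Two points lie outside the counting argument. The passage from one level to the
  next needs a positive dilation factor, so the value of the polynomial at 0 is computed separately.
  And Ehrhart positivity includes being a lattice polytope: a point is written as a convex
  combination of two roundings of itself that have fewer distinct fractional parts, until it is
  integral.\<close>

definition det_fun :: "nat \<Rightarrow> (nat \<Rightarrow> nat \<Rightarrow> 'a::comm_ring_1) \<Rightarrow> 'a" where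
  "det_fun k f = det (mat k k (\<lambda>(i, j). f i j))"

lemma det_fun_leibniz:
  "det_fun k f = (\<Sum>p | p permutes {0..<k}. signof p * (\<Prod>i = 0..<k. f i (p i)))"
proof -
  have "(\<Prod>i = 0..<k. mat k k (\<lambda>(i, j). f i j) $$ (i, p i)) = (\<Prod>i = 0..<k. f i (p i))"
    if "p permutes {0..<k}" for p
    using permutes_in_image[OF that] by (intro prod.cong) auto
  then show ?thesis
    unfolding det_fun_def det_def'[OF mat_carrier] by (auto intro!: sum.cong)
qed

lemma det_fun_cong:
  assumes "\<And>i j. i < k \<Longrightarrow> j < k \<Longrightarrow> f i j = g i j"
  shows "det_fun k f = det_fun k g"
  unfolding det_fun_def using assms by (intro arg_cong[of _ _ det] eq_matI) auto

text \<open>Linearity in one row. Matrices are passed as functions of two indices so that replacing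
  a row is a function update, free of dimension conditions.\<close>

lemma det_fun_row_sum:
  assumes "r < k"
  shows "(\<Sum>s\<in>S. det_fun k (f(r := g s))) = det_fun k (f(r := (\<lambda>j. \<Sum>s\<in>S. g s j)))"
proof -
  have split: "(\<Prod>i = 0..<k. (f(r := h)) i (p i)) = h (p r) * (\<Prod>i\<in>{0..<k} - {r}. f i (p i))"
    for h :: "nat \<Rightarrow> 'a" and p
  proof -
    have "(\<Prod>i = 0..<k. (f(r := h)) i (p i))
        = (f(r := h)) r (p r) * (\<Prod>i\<in>{0..<k} - {r}. (f(r := h)) i (p i))"
      using assms by (intro prod.remove) auto
    also have "(\<Prod>i\<in>{0..<k} - {r}. (f(r := h)) i (p i)) = (\<Prod>i\<in>{0..<k} - {r}. f i (p i))"
      by (rule prod.cong) auto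
    finally show ?thesis by simp
  qed
  show ?thesis
    unfolding det_fun_leibniz split
    by (subst sum.swap) (simp add: sum_distrib_left sum_distrib_right mult.assoc)
qed

lemma det_fun_row_diff:
  assumes "r < k"
  shows "det_fun k (f(r := (\<lambda>j. a j - b j))) = det_fun k (f(r := a)) - det_fun k (f(r := b))"
proof -
  \<comment> \<open>The row \<open>a\<close> is the sum of the rows \<open>a - b\<close> and
    \<open>b\<close>, indexed by the booleans.\<close>
  have "(\<Sum>s\<in>UNIV. det_fun k (f(r := (if s then (\<lambda>j. a j - b j) else b)))) = det_fun k (f(r := a))"
    using assms by (subst det_fun_row_sum) (auto simp: UNIV_bool intro!: arg_cong[of _ _ "det_fun k"])
  then show ?thesis by (simp add: UNIV_bool algebra_simps)
qed

lemma det_fun_equal_rows: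
  assumes "r < k" "s < k" "r \<noteq> s" "f r = f s"
  shows "det_fun k f = 0"
  unfolding det_fun_def
  by (rule det_identical_rows[OF _ \<open>r \<noteq> s\<close> \<open>r < k\<close> \<open>s < k\<close>])
     (use assms in \<open>auto intro!: eq_vecI\<close>)

text \<open>Pigeonhole: a permutation cannot send the \<open>k - p\<close> rows from
  \<open>p\<close> on into the \<open>k - p - 1\<close> columns beyond \<open>p\<close>, so every
  Leibniz product meets the zero block.\<close>

lemma det_fun_zero_block:
  assumes "p < k" "\<And>i j. p \<le> i \<Longrightarrow> i < k \<Longrightarrow> j \<le> p \<Longrightarrow> f i j = 0"
  shows "det_fun k f = 0"
  unfolding det_fun_leibniz
proof (rule sum.neutral, rule ballI)
  fix q assume "q \<in> {q. q permutes {0..<k}}"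
  then have q: "q permutes {0..<k}" by simp
  have "\<exists>i. p \<le> i \<and> i < k \<and> q i \<le> p"
  proof (rule ccontr)
    assume "\<not> ?thesis"
    then have "q ` {p..<k} \<subseteq> {Suc p..<k}"
      using permutes_in_image[OF q] by (auto simp: not_le Suc_le_eq)
    then have "card (q ` {p..<k}) \<le> card {Suc p..<k}"
      by (intro card_mono) auto
    moreover have "card (q ` {p..<k}) = card {p..<k}"
      using permutes_inj[OF q] by (intro card_image) (auto intro: inj_on_subset)
    ultimately show False using assms(1) by simp
  qed
  then obtain i where "i \<in> {0..<k}" "f i (q i) = 0"
    using assms(2) by auto
  then have "(\<Prod>i = 0..<k. f i (q i)) = 0" by (intro prod_zero) auto
  then show "signof q * (\<Prod>i = 0..<k. f i (q i)) = 0" by simp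
qed

lemma det_fun_lower_triangular:
  assumes "\<And>i j. i < j \<Longrightarrow> j < k \<Longrightarrow> f i j = 0" "\<And>i. i < k \<Longrightarrow> f i i = 1"
  shows "det_fun k f = 1"
proof -
  have "det_fun k f = prod_list (diag_mat (mat k k (\<lambda>(i, j). f i j)))"
    unfolding det_fun_def by (rule det_lower_triangular[where n = k]) (use assms(1) in auto)
  also have "\<dots> = 1"
    unfolding prod_list_diag_prod using assms(2) by (auto intro!: prod.neutral)
  finally show ?thesis .
qed

lemma det_fun_block_triangular:
  fixes f :: "nat \<Rightarrow> nat \<Rightarrow> 'a::idom"
  assumes "\<And>i j. i < m \<Longrightarrow> j < l \<Longrightarrow> f (l + i) j = 0"
  shows "det_fun (l + m) f = det_fun l f * det_fun m (\<lambda>i j. f (l + i) (l + j))"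
proof -
  have "mat (l + m) (l + m) (\<lambda>(i, j). f i j) = four_block_mat (mat l l (\<lambda>(i, j). f i j))
      (mat l m (\<lambda>(i, j). f i (l + j))) (0\<^sub>m m l) (mat m m (\<lambda>(i, j). f (l + i) (l + j)))"
  proof (rule eq_matI, goal_cases)
    case (1 i j)
    then show ?case using assms[of "i - l" j] by (auto simp: not_less)
  qed auto
  then show ?thesis
    unfolding det_fun_def by (simp add: det_four_block_mat_lower_left_zero[of _ l _ m])
qed

lemma poly_det_fun: "poly (det_fun k f) x = det_fun k (\<lambda>i j. poly (f i j) x)"
  unfolding det_fun_leibniz poly_sum poly_mult poly_prod
  by (intro sum.cong) (auto simp: sign_def)

text \<open>Below row 0 the last column is zero, so expanding along it leaves one cofactor. Deleting
  row 0 moves the subdiagonal of ones onto the diagonal of a lower triangular matrix. The sign is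
  that of a \<open>k\<close>-cycle.\<close>

lemma det_fun_strictly_lower:
  fixes f :: "nat \<Rightarrow> nat \<Rightarrow> 'a::comm_ring_1"
  assumes "k > 0" "\<And>i j. 0 < i \<Longrightarrow> i \<le> j \<Longrightarrow> j < k \<Longrightarrow> f i j = 0"
    and "\<And>i. Suc i < k \<Longrightarrow> f (Suc i) i = 1"
  shows "det_fun k f = (- 1) ^ (k - 1) * f 0 (k - 1)"
proof -
  let ?A = "mat k k (\<lambda>(i, j). f i j)"
  have "det ?A = (\<Sum>i<k. ?A $$ (i, k - 1) * cofactor ?A i (k - 1))"
    by (rule laplace_expansion_column) (use assms in auto)
  also have "\<dots> = (\<Sum>i\<in>{0}. ?A $$ (i, k - 1) * cofactor ?A i (k - 1))"
  proof (rule sum.mono_neutral_right)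
    show "\<forall>i\<in>{..<k} - {0}. ?A $$ (i, k - 1) * cofactor ?A i (k - 1) = 0"
    proof
      fix i assume "i \<in> {..<k} - {0}"
      then have "f i (k - 1) = 0" "i < k" using assms(2)[of i "k - 1"] by auto
      then show "?A $$ (i, k - 1) * cofactor ?A i (k - 1) = 0" by simp
    qed
  qed (use assms(1) in auto)
  also have "\<dots> = f 0 (k - 1) * cofactor ?A 0 (k - 1)"
    using assms by simp
  also have "cofactor ?A 0 (k - 1) = (- 1) ^ (k - 1) * det (mat_delete ?A 0 (k - 1))"
    by (simp add: cofactor_def)
  also have "mat_delete ?A 0 (k - 1) = mat (k - 1) (k - 1) (\<lambda>(i, j). f (Suc i) j)"
    unfolding mat_delete_def by (rule eq_matI) auto
  also have "det \<dots> = det_fun (k - 1) (\<lambda>i j. f (Suc i) j)"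
    by (simp add: det_fun_def)
  also have "\<dots> = 1"
    by (rule det_fun_lower_triangular) (use assms in auto)
  finally show ?thesis by (simp add: det_fun_def)
qed

section \<open>Order polynomials of skew shapes\<close>

text \<open>For \<open>e = 0\<close> and natural \<open>a\<close>, the value at \<open>t\<close> is
  the number of multisets of size \<open>a\<close> from \<open>t\<close> kinds. The offset
  \<open>e\<close> is the signed distance from the diagonal in Kreweras' determinant.\<close>

definition binom_entry :: "int \<Rightarrow> int \<Rightarrow> real poly" where
  "binom_entry a e = (if a + e < 0 then 0 else
     Polynomial.smult (1 / fact (nat (a + e))) (\<Prod>l = 0..<nat (a + e). [:of_int (a - 1) - of_nat l, 1:]))"

lemma poly_binom_entry:
  "poly (binom_entry a e) t = (if a + e < 0 then 0 else (t + of_int a - 1) gchoose nat (a + e))"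
  by (simp add: binom_entry_def gbinomial_prod_rev poly_prod algebra_simps)

lemma poly_binom_entry_shift: "poly (binom_entry (a - 1) e) (t + 1) = poly (binom_entry a (e - 1)) t"
  by (simp add: poly_binom_entry algebra_simps)

lemma poly_binom_entry_Suc: "poly (binom_entry a e) (t + 1) = poly (binom_entry a e) t + poly (binom_entry a (e - 1)) t"
proof (cases "a + e \<le> 0")
  case False
  then have "nat (a + e - 1) = nat (a + e) - 1" "nat (a + e) > 0" by auto
  then show ?thesis
    using False gbinomial_reduce_nat[of "nat (a + e)" "t + of_int a"]
    by (auto simp: poly_binom_entry algebra_simps)
qed (auto simp: poly_binom_entry)

text \<open>Parts are numbered from 0 and continued by 0, so that equality and containment of
  diagrams are equality and pointwise order of functions.\<close>

definition partitions :: "nat \<Rightarrow> (nat \<Rightarrow> nat) set" where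
  "partitions k = {p. antimono p \<and> (\<forall>i\<ge>k. p i = 0)}"

lemma partitions_antimono: "p \<in> partitions k \<Longrightarrow> i \<le> j \<Longrightarrow> p j \<le> p i"
  by (auto simp: partitions_def antimono_def)

lemma partitions_zero: "p \<in> partitions k \<Longrightarrow> k \<le> i \<Longrightarrow> p i = 0"
  by (auto simp: partitions_def)

lemma partitionsI:
  assumes "\<And>i. p (Suc i) \<le> p i" "\<And>i. k \<le> i \<Longrightarrow> p i = 0"
  shows "p \<in> partitions k"
  using assms by (auto simp: partitions_def antimono_iff_le_Suc)

text \<open>Sums over an interval of partitions are taken over the whole ideal below its top: the
  order polynomial vanishes at shapes that do not contain the bottom
  (\<open>skew_poly_eq_0\<close>).\<close>

definition below :: "nat \<Rightarrow> (nat \<Rightarrow> nat) \<Rightarrow> (nat \<Rightarrow> nat) set" where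
  "below k p = {q \<in> partitions k. q \<le> p}"

lemma finite_below:
  assumes "p \<in> partitions k"
  shows "finite (below k p)"
proof (rule finite_subset)
  show "below k p \<subseteq> {q. \<forall>i. (i \<in> {..<k} \<longrightarrow> q i \<in> {..p 0}) \<and> (i \<notin> {..<k} \<longrightarrow> q i = 0)}"
    using partitions_antimono[OF assms, of 0]
    by (auto simp: below_def le_fun_def intro: order_trans partitions_zero)
  show "finite {q. \<forall>i. (i \<in> {..<k} \<longrightarrow> q i \<in> {..p 0}) \<and> (i \<notin> {..<k} \<longrightarrow> q i = (0::nat))}"
    by (rule finite_set_of_finite_funs) auto
qed

text \<open>Kreweras' determinant: its value at \<open>n\<close> is the number of chains
  \<open>p = \<nu>\<^sub>0 \<le> \<nu>\<^sub>1 \<le> \<dots> \<le> \<nu>\<^sub>n = q\<close> of partitions.\<close>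

definition skew_poly :: "nat \<Rightarrow> (nat \<Rightarrow> nat) \<Rightarrow> (nat \<Rightarrow> nat) \<Rightarrow> real poly" where
  "skew_poly k p q = det_fun k (\<lambda>i j. binom_entry (int (q i) - int (p j)) (int j - int i))"

text \<open>If \<open>q l < p l\<close>, then the entries in the rows from \<open>l\<close> on and
  the columns up to \<open>l\<close> have a negative lower index.\<close>

lemma skew_poly_eq_0:
  assumes "p \<in> partitions k" "q \<in> partitions k" "\<not> p \<le> q"
  shows "skew_poly k p q = 0"
proof -
  from assms(3) obtain l where l: "q l < p l" by (auto simp: le_fun_def not_le)
  then have "l < k" using partitions_zero[OF assms(1), of l] by (cases "l < k") auto
  then show ?thesis
    unfolding skew_poly_def
  proof (rule det_fun_zero_block)
    fix i j assume "l \<le> i" "j \<le> l"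
    then show "binom_entry (int (q i) - int (p j)) (int j - int i) = 0"
      using l partitions_antimono[OF assms(1), of j l] partitions_antimono[OF assms(2), of l i]
      by (auto simp: binom_entry_def)
  qed
qed

text \<open>At 1 an entry is \<open>a\<close> choose \<open>a + e\<close>. For
  \<open>p \<le> q\<close> this is 0 above the diagonal and 1 on it.\<close>

lemma poly_skew_poly_1:
  assumes "p \<in> partitions k" "q \<in> partitions k"
  shows "poly (skew_poly k p q) 1 = (if p \<le> q then 1 else 0)"
proof (cases "p \<le> q")
  case True
  have le: "p j \<le> q i" if "i \<le> j" for i j
    using True partitions_antimono[OF assms(1) that] by (meson le_funD order_trans)
  have "det_fun k (\<lambda>i j. poly (binom_entry (int (q i) - int (p j)) (int j - int i)) 1) = 1"
  proof (rule det_fun_lower_triangular)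
    fix i j :: nat assume "i < j"
    then have *: "nat (int (q i) - int (p j) + (int j - int i)) > q i - p j"
        "1 + real_of_int (int (q i) - int (p j)) - 1 = real (q i - p j)"
      using le[of i j] by auto
    show "poly (binom_entry (int (q i) - int (p j)) (int j - int i)) 1 = 0"
      unfolding poly_binom_entry *(2) binomial_gbinomial[symmetric] using *(1) by simp
  next
    fix i
    have *: "nat (int (q i) - int (p i) + (int i - int i)) = q i - p i"
        "1 + real_of_int (int (q i) - int (p i)) - 1 = real (q i - p i)"
      using le[of i i] by auto
    show "poly (binom_entry (int (q i) - int (p i)) (int i - int i)) 1 = 1"
      unfolding poly_binom_entry * binomial_gbinomial[symmetric] using le[of i i] by simp
  qed
  then show ?thesis using True by (simp add: skew_poly_def poly_det_fun)
qed (simp add: skew_poly_eq_0 assms)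

text \<open>Hockey-stick identity: by \<open>poly_binom_entry_Suc\<close> and
  \<open>poly_binom_entry_shift\<close> each summand is a difference of consecutive entries at
  \<open>t + 1\<close>. The lower end is written with \<open>e - 1\<close> at \<open>t\<close>
  because in this form it is an entry of the next row.\<close>

lemma sum_poly_binom_entry:
  assumes "u \<le> l"
  shows "(\<Sum>v = u..l. poly (binom_entry (int v - c) e) t)
      = poly (binom_entry (int l - c) e) (t + 1) - poly (binom_entry (int u - c) (e - 1)) t"
  using assms
proof (induction l rule: dec_induct)
  case base
  then show ?case by (simp add: poly_binom_entry_Suc)
next
  case (step l)
  have "poly (binom_entry (int (Suc l) - c) (e - 1)) t = poly (binom_entry (int l - c) e) (t + 1)"
    using poly_binom_entry_shift[of "int (Suc l) - c" e t] by (simp add: algebra_simps)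
  then show ?case
    using step poly_binom_entry_Suc[of "int (Suc l) - c" e t] by simp
qed

text \<open>The sum over the part of index \<open>r\<close> of \<open>\<nu>\<close> telescopes: its lower boundary term is the row
  of index \<open>r + 1\<close> of the determinant.\<close>

lemma sum_skew_poly:
  assumes q: "q \<in> partitions k"
  shows "(\<Sum>\<nu>\<in>below k q. poly (skew_poly k p \<nu>) t) = poly (skew_poly k p q) (t + 1)"
proof -
  define R where "R s v i j = poly (binom_entry (int v - int (p j)) (int j - int i)) s" for s and v i j :: nat
  \<comment> \<open>The rows of \<nu> at \<open>t\<close> are turned one by one into the rows of
    \<open>q\<close> at \<open>t + 1\<close>. The sum over \<open>D r\<close> does not depend on
    \<open>r\<close>; it is the left side for \<open>r = 0\<close> and the right side for
    \<open>r = k\<close>.\<close>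
  define f where "f r \<nu> = (\<lambda>i. if i < r then R (t + 1) (q i) i else R t (\<nu> i) i)" for r \<nu>
  define D where "D r = {\<nu> \<in> below k q. \<forall>i<r. \<nu> i = q i}" for r
  have step: "(\<Sum>\<nu>\<in>D r. det_fun k (f r \<nu>)) = (\<Sum>\<nu>\<in>D (Suc r). det_fun k (f (Suc r) \<nu>))" if r: "r < k" for r
  proof -
    \<comment> \<open>Part \<open>r\<close> of \<nu> is split off as \<open>v\<close>, and
      \<open>w\<close> is \<nu> with that part raised to \<open>q r\<close>. As the earlier parts
      agree with \<open>q\<close>, the only constraints on \<open>v\<close> are
      \<open>w (Suc r)\<close> and \<open>q r\<close>.\<close>
    have "(\<Sum>\<nu>\<in>D r. det_fun k (f r \<nu>))
        = (\<Sum>(w, v)\<in>Sigma (D (Suc r)) (\<lambda>w. {w (Suc r)..q r}). det_fun k (f r (w(r := v))))"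
    proof (rule sum.reindex_bij_witness[where i = "\<lambda>(w, v). w(r := v)" and j = "\<lambda>\<nu>. (\<nu>(r := q r), \<nu> r)"],
        goal_cases)
      case (2 \<nu>)
      then have \<nu>: "\<nu> \<in> partitions k" "\<nu> \<le> q" "\<forall>i<r. \<nu> i = q i" by (auto simp: D_def below_def)
      have "\<nu>(r := q r) \<in> partitions k"
      proof (rule partitionsI)
        fix i
        show "(\<nu>(r := q r)) (Suc i) \<le> (\<nu>(r := q r)) i"
          using partitions_antimono[OF \<nu>(1), of i "Suc i"] partitions_antimono[OF q, of i "Suc i"] \<nu>(3)
            le_funD[OF \<nu>(2), of "Suc i"] le_funD[OF \<nu>(2), of i]
          by auto
      qed (use r \<nu> partitions_zero in auto)
      then show ?case
        using \<nu> partitions_antimono[OF \<nu>(1), of r "Suc r"]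
        by (auto simp: D_def below_def le_fun_def less_Suc_eq)
    next
      case (4 b)
      then obtain w v where b: "b = (w, v)" and w: "w \<in> partitions k" "w \<le> q" "\<forall>i<Suc r. w i = q i"
        and v: "w (Suc r) \<le> v" "v \<le> q r"
        by (auto simp: D_def below_def)
      have "w(r := v) \<in> partitions k"
      proof (rule partitionsI)
        fix i
        show "(w(r := v)) (Suc i) \<le> (w(r := v)) i"
          using partitions_antimono[OF w(1), of i "Suc i"] partitions_antimono[OF q, of i "Suc i"] w(3) v
          by auto
      qed (use r w partitions_zero in auto)
      then show ?case
        using w v b by (auto simp: D_def below_def le_fun_def)
    qed (auto simp: D_def)
    also have "\<dots> = (\<Sum>w\<in>D (Suc r). \<Sum>v = w (Suc r)..q r. det_fun k (f r (w(r := v))))"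
      using finite_below[OF q] by (subst sum.Sigma) (auto simp: D_def)
    also have "\<dots> = (\<Sum>w\<in>D (Suc r). det_fun k (f (Suc r) w))"
    proof (rule sum.cong[OF refl])
      fix w assume "w \<in> D (Suc r)"
      then have w: "w \<in> partitions k" "w r = q r" by (auto simp: D_def below_def)
      have le: "w (Suc r) \<le> q r" using partitions_antimono[OF w(1), of r "Suc r"] w(2) by simp
      have row: "(\<Sum>v = w (Suc r)..q r. R t v r j) = R (t + 1) (q r) r j - R t (w (Suc r)) (Suc r) j" for j
      proof -
        have e: "int j - int (Suc r) = int j - int r - 1" by simp
        show ?thesis unfolding R_def e by (rule sum_poly_binom_entry[OF le])
      qed
      have "(\<Sum>v = w (Suc r)..q r. det_fun k (f r (w(r := v))))
          = (\<Sum>v = w (Suc r)..q r. det_fun k ((f r w)(r := R t v r)))"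
        by (intro sum.cong arg_cong[of _ _ "det_fun k"]) (auto simp: f_def)
      also have "\<dots> = det_fun k ((f r w)(r := (\<lambda>j. R (t + 1) (q r) r j - R t (w (Suc r)) (Suc r) j)))"
        by (simp only: det_fun_row_sum[OF r] row)
      also have "\<dots> = det_fun k ((f r w)(r := R (t + 1) (q r) r))
          - det_fun k ((f r w)(r := R t (w (Suc r)) (Suc r)))"
        by (rule det_fun_row_diff[OF r])
      \<comment> \<open>The boundary term repeats row \<open>r + 1\<close>. For the last row it is
        zero instead: the lower indices \<open>j - k - p j\<close> are negative.\<close>
      also have "det_fun k ((f r w)(r := R t (w (Suc r)) (Suc r))) = 0"
      proof (cases "Suc r < k")
        case True
        then show ?thesis by (intro det_fun_equal_rows[of r _ "Suc r"]) (auto simp: f_def)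
      next
        case False
        then have "det_fun k ((f r w)(r := R t (w (Suc r)) (Suc r))) = det_fun k ((f r w)(r := (\<lambda>j. 0)))"
          using r partitions_zero[OF w(1), of "Suc r"]
          by (intro det_fun_cong) (auto simp: R_def poly_binom_entry)
        then show ?thesis using det_fun_row_sum[OF r, where S = "{}" and f = "f r w"] by simp
      qed
      also have "(f r w)(r := R (t + 1) (q r) r) = f (Suc r) w" by (auto simp: f_def)
      finally show "(\<Sum>v = w (Suc r)..q r. det_fun k (f r (w(r := v)))) = det_fun k (f (Suc r) w)"
        by (simp only: diff_0_right)
    qed
    finally show ?thesis .
  qed
  have "(\<Sum>\<nu>\<in>D 0. det_fun k (f 0 \<nu>)) = (\<Sum>\<nu>\<in>D r. det_fun k (f r \<nu>))" if "r \<le> k" for r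
    using that by (induction r) (auto simp: step)
  from this[of k] have "(\<Sum>\<nu>\<in>D 0. det_fun k (f 0 \<nu>)) = (\<Sum>\<nu>\<in>D k. det_fun k (f k \<nu>))" by simp
  also have "D k = {q}"
  proof -
    have "\<nu> = q" if "\<nu> \<in> D k" for \<nu>
    proof
      fix i show "\<nu> i = q i"
        using that q by (cases "i < k") (auto simp: D_def below_def partitions_zero)
    qed
    then show ?thesis using q by (auto simp: D_def below_def)
  qed
  also have "(\<Sum>\<nu>\<in>{q}. det_fun k (f k \<nu>)) = poly (skew_poly k p q) (t + 1)"
    by (auto simp: f_def R_def skew_poly_def poly_det_fun intro!: det_fun_cong)
  also have "(\<Sum>\<nu>\<in>D 0. det_fun k (f 0 \<nu>)) = (\<Sum>\<nu>\<in>below k q. poly (skew_poly k p \<nu>) t)"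
    by (auto simp: D_def f_def R_def skew_poly_def poly_det_fun intro!: sum.cong det_fun_cong)
  finally show ?thesis .
qed

text \<open>Moebius inversion, by induction on the size of the ideal below \<open>q\<close>.\<close>

lemma below_sums_eqD:
  assumes "\<And>q. q \<in> partitions k \<Longrightarrow> (\<Sum>\<nu>\<in>below k q. f \<nu>) = (\<Sum>\<nu>\<in>below k q. g \<nu> :: 'a::ab_group_add)"
    and "q \<in> partitions k"
  shows "f q = g q"
  using assms(2)
proof (induction "card (below k q)" arbitrary: q rule: less_induct)
  case less
  have "f \<nu> = g \<nu>" if "\<nu> \<in> below k q - {q}" for \<nu>
  proof (rule less.hyps)
    show "\<nu> \<in> partitions k" using that by (simp add: below_def)
    have "below k \<nu> \<subseteq> below k q" "q \<in> below k q" "q \<notin> below k \<nu>"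
      using that less.prems by (auto simp: below_def)
    then have "below k \<nu> \<subset> below k q" by blast
    then show "card (below k \<nu>) < card (below k q)"
      by (rule psubset_card_mono[OF finite_below[OF less.prems]])
  qed
  then have "(\<Sum>\<nu>\<in>below k q - {q}. f \<nu>) = (\<Sum>\<nu>\<in>below k q - {q}. g \<nu>)"
    by (rule sum.cong[OF refl])
  moreover have "q \<in> below k q" using less.prems by (simp add: below_def)
  ultimately show ?case
    using assms(1)[OF less.prems] finite_below[OF less.prems]
    by (simp add: sum.remove[of _ q])
qed

text \<open>\<open>sum_skew_poly\<close> is read backwards: the values at 1, which are known, are
  the sums over ideals of the values at 0, and these sums determine their summands.\<close>

lemma poly_skew_poly_0:
  assumes "p \<in> partitions k" "q \<in> partitions k"
  shows "poly (skew_poly k p q) 0 = (if p = q then 1 else 0)"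
proof (rule below_sums_eqD[where f = "\<lambda>q. poly (skew_poly k p q) 0" and g = "\<lambda>q. if p = q then 1 else 0",
    OF _ assms(2)])
  fix r assume r: "r \<in> partitions k"
  show "(\<Sum>\<nu>\<in>below k r. poly (skew_poly k p \<nu>) 0) = (\<Sum>\<nu>\<in>below k r. if p = \<nu> then 1 else 0)"
    using sum_skew_poly[OF r, of p 0] poly_skew_poly_1[OF assms(1) r] finite_below[OF r] assms(1)
    by (simp add: below_def)
qed

text \<open>Each side satisfies the recursion \<open>sum_skew_poly\<close> in \<open>n\<close>. The
  range is the ideal of some \<open>m\<close> above \<open>q\<close>, which stays fixed while
  \<open>q\<close> varies in the induction.\<close>

lemma poly_skew_poly_add:
  assumes "p \<in> partitions k" "q \<in> partitions k" "q \<le> m" "m \<in> partitions k"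
  shows "poly (skew_poly k p q) (t + real n)
      = (\<Sum>\<nu>\<in>below k m. poly (skew_poly k p \<nu>) t * poly (skew_poly k \<nu> q) (real n))"
  using assms(2,3)
proof (induction n arbitrary: q)
  case 0
  have "(\<Sum>\<nu>\<in>below k m. poly (skew_poly k p \<nu>) t * poly (skew_poly k \<nu> q) (real 0))
      = (\<Sum>\<nu>\<in>below k m. if \<nu> = q then poly (skew_poly k p \<nu>) t else 0)"
    using 0 by (intro sum.cong) (auto simp: poly_skew_poly_0 below_def)
  then show ?case
    using 0 finite_below[OF assms(4)] by (simp add: below_def)
next
  case (Suc n)
  have "poly (skew_poly k p q) (t + real (Suc n)) = poly (skew_poly k p q) (t + real n + 1)"
    by (simp add: algebra_simps)
  also have "\<dots> = (\<Sum>\<mu>\<in>below k q. poly (skew_poly k p \<mu>) (t + real n))"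
    by (simp add: sum_skew_poly Suc)
  also have "\<dots> = (\<Sum>\<mu>\<in>below k q. \<Sum>\<nu>\<in>below k m. poly (skew_poly k p \<nu>) t * poly (skew_poly k \<nu> \<mu>) (real n))"
    by (rule sum.cong[OF refl], rule Suc.IH) (use Suc.prems in \<open>auto simp: below_def\<close>)
  also have "\<dots> = (\<Sum>\<nu>\<in>below k m. poly (skew_poly k p \<nu>) t * (\<Sum>\<mu>\<in>below k q. poly (skew_poly k \<nu> \<mu>) (real n)))"
    by (subst sum.swap) (simp add: sum_distrib_left)
  also have "\<dots> = (\<Sum>\<nu>\<in>below k m. poly (skew_poly k p \<nu>) t * poly (skew_poly k \<nu> q) (real (Suc n)))"
    by (simp add: sum_skew_poly Suc.prems add.commute)
  finally show ?case .
qed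

section \<open>The constant and linear coefficients\<close>

lemma coeff_mult_1: "coeff (p * q) 1 = coeff p 0 * coeff q 1 + coeff p 1 * coeff q (0::nat)"
  by (simp add: coeff_mult)

lemma coeff_0_binom_entry:
  assumes "a \<ge> 1" "a + e \<ge> 0"
  shows "coeff (binom_entry a e) 0 = real (nat (a - 1) choose nat (a + e))"
proof -
  have "real_of_int a - 1 = real (nat (a - 1))" using assms by simp
  then show ?thesis
    using assms unfolding poly_0_coeff_0[symmetric] poly_binom_entry by (simp add: binomial_gbinomial)
qed

text \<open>The factor of index \<open>a - 1\<close> is the variable itself, so the linear
  coefficient is, up to the factorial, the product of the other factors at 0: \<open>a - 1\<close>
  positive ones before it and \<open>e\<close> negative ones after it.\<close>

lemma coeff_1_binom_entry_sign:
  assumes "a \<ge> 1"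
  shows "(- 1) ^ e * coeff (binom_entry a (int e)) 1 \<ge> 0"
proof -
  define d l where "d = nat (a + int e)" and "l = nat (a - 1)"
  have d: "d = l + 1 + e" and a: "a - 1 = int l" using assms by (auto simp: d_def l_def)
  let ?g = "\<lambda>i. [:real l - real i, 1:]"
  have split: "{0..<d} = {0..<l} \<union> {l} \<union> {Suc l..<d}" using d by auto
  have "(\<Prod>i = 0..<d. ?g i) = (\<Prod>i = 0..<l. ?g i) * ?g l * (\<Prod>i = Suc l..<d. ?g i)"
    unfolding split by (subst prod.union_disjoint; (subst prod.union_disjoint)?) (auto simp: mult_ac)
  also have "\<dots> = [:0, 1:] * ((\<Prod>i = 0..<l. ?g i) * (\<Prod>i = Suc l..<d. ?g i))"
    by (simp add: mult_ac)
  finally have "coeff (\<Prod>i = 0..<d. ?g i) 1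
      = coeff ((\<Prod>i = 0..<l. ?g i) * (\<Prod>i = Suc l..<d. ?g i)) 0"
    by (simp add: coeff_pCons)
  also have "\<dots> = (\<Prod>i = 0..<l. real l - real i) * (\<Prod>i = Suc l..<d. real l - real i)"
    by (simp add: poly_0_coeff_0[symmetric] poly_prod)
  also have "(\<Prod>i = Suc l..<d. real l - real i) = (\<Prod>i = Suc l..<d. (- 1) * (real i - real l))"
    by simp
  also have "\<dots> = (- 1) ^ e * (\<Prod>i = Suc l..<d. real i - real l)"
    unfolding prod.distrib using d by simp
  finally have *: "coeff (\<Prod>i = 0..<d. ?g i) 1
      = (- 1) ^ e * ((\<Prod>i = 0..<l. real l - real i) * (\<Prod>i = Suc l..<d. real i - real l))"
    by (simp add: mult_ac)
  have "binom_entry a (int e) = Polynomial.smult (1 / fact d) (\<Prod>i = 0..<d. ?g i)"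
    using assms unfolding binom_entry_def a d_def[symmetric] by simp
  then have "(- 1) ^ e * coeff (binom_entry a (int e)) 1 = ((- 1) ^ e * (- 1) ^ e)
      * ((\<Prod>i = 0..<l. real l - real i) * (\<Prod>i = Suc l..<d. real i - real l)) / fact d"
    using * by (simp add: mult_ac)
  also have "(- 1) ^ e * (- 1) ^ e = (1::real)" by (simp flip: power_add)
  finally have "(- 1) ^ e * coeff (binom_entry a (int e)) 1
      = ((\<Prod>i = 0..<l. real l - real i) * (\<Prod>i = Suc l..<d. real i - real l)) / fact d"
    by simp
  also have "\<dots> \<ge> 0" by (intro divide_nonneg_nonneg mult_nonneg_nonneg prod_nonneg) auto
  finally show ?thesis .
qed

text \<open>If \<open>q i \<le> p (i - 1)\<close> for some \<open>i\<close>, the determinant is block triangular. Otherwise its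
  entries on and above the diagonal vanish at \<open>0\<close>, and the only permutation that contributes to
  the linear coefficient is the cycle.\<close>

lemma coeff_skew_poly_nonneg:
  assumes "p \<le> q" "antimono p" "antimono q"
  shows "coeff (skew_poly k p q) 0 \<ge> 0 \<and> coeff (skew_poly k p q) 1 \<ge> 0"
  using assms
proof (induction k arbitrary: p q rule: less_induct)
  case (less k)
  have p: "p j \<le> p i" and q: "q j \<le> q i" if "i \<le> j" for i j
    using less.prems that by (auto dest: antimonoD)
  have pq: "p i \<le> q i" for i using less.prems by (simp add: le_funD)
  \<comment> \<open>For \<open>k > 1\<close> the strict overlap of consecutive rows already forces
    \<open>p l < q l\<close> for all rows; only a single row can be empty without being cut off, and
    then the polynomial is 1.\<close>
  consider (empty) "k = 0" | (one) "k = 1" "p 0 = q 0"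
    | (cut) l where "0 < l" "l < k" "q l \<le> p (l - 1)"
    | (conn) "k > 0" "\<And>l. l < k \<Longrightarrow> p l < q l" "\<And>l. Suc l < k \<Longrightarrow> p l < q (Suc l)"
  proof -
    consider "k = 0" | "\<exists>l. 0 < l \<and> l < k \<and> q l \<le> p (l - 1)"
      | "k > 0" "\<And>l. 0 < l \<Longrightarrow> l < k \<Longrightarrow> p (l - 1) < q l"
      using not_le by blast
    then show thesis
    proof cases
      case 3
      have A: "p l < q (Suc l)" if "Suc l < k" for l using 3(2)[of "Suc l"] that by simp
      have B: "p l < q l" if "0 < l" "l < k" for l
        using 3(2)[OF that] p[of "l - 1" l] by simp
      have C: "p 0 < q 0" if "k > 1" using A[of 0] q[of 0 1] that by simp
      show thesis
      proof (cases "k = 1 \<and> p 0 = q 0")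
        case False
        then have "p 0 < q 0" using C 3(1) pq[of 0] by (cases "k > 1") auto
        then have "p l < q l" if "l < k" for l using B that by (cases "l = 0") auto
        then show thesis using conn A 3(1) by blast
      qed (use one in blast)
    qed (use empty cut in blast)+
  qed
  then show ?case
  proof cases
    case empty
    then show ?thesis by (simp add: skew_poly_def det_fun_leibniz)
  next
    case one
    then have "skew_poly k p q = 1"
      by (auto simp: skew_poly_def binom_entry_def intro!: det_fun_lower_triangular)
    then show ?thesis by simp
  next
    case (cut l)
    define m where "m = k - l"
    have m: "k = l + m" "m < k" using cut by (auto simp: m_def)
    have "skew_poly k p q = skew_poly l p q * skew_poly m (\<lambda>i. p (l + i)) (\<lambda>i. q (l + i))"
      unfolding skew_poly_def m(1)
    proof (subst det_fun_block_triangular)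
      fix i j assume "i < m" "j < l"
      then have "q (l + i) \<le> p j"
        using q[of l "l + i"] p[of j "l - 1"] cut by linarith
      then show "binom_entry (int (q (l + i)) - int (p j)) (int j - int (l + i)) = 0"
        using \<open>j < l\<close> by (auto simp: binom_entry_def)
    qed auto
    \<comment> \<open>The constant coefficients are carried through the induction because the linear
      coefficient of a product involves them.\<close>
    moreover have "coeff (skew_poly l p q) 0 \<ge> 0 \<and> coeff (skew_poly l p q) 1 \<ge> 0"
      by (rule less.IH) (use cut less.prems in auto)
    moreover have "coeff (skew_poly m (\<lambda>i. p (l + i)) (\<lambda>i. q (l + i))) 0 \<ge> 0
        \<and> coeff (skew_poly m (\<lambda>i. p (l + i)) (\<lambda>i. q (l + i))) 1 \<ge> 0"
      by (rule less.IH) (use m p q pq in \<open>auto simp: le_fun_def antimono_def\<close>)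
    ultimately show ?thesis by (simp only: coeff_mult_0 coeff_mult_1) simp
  next
    case conn
    let ?e = "\<lambda>i j. binom_entry (int (q i) - int (p j)) (int j - int i)"
    have a: "int (q i) - int (p j) \<ge> 1" if "i \<le> Suc j" "j < k" "i < k" for i j
    proof (cases "i \<le> j")
      case True
      then show ?thesis using q[OF True] conn(2)[of j] that by linarith
    next
      case False
      then show ?thesis using conn(3)[of j] that by (auto simp: le_Suc_eq)
    qed
    \<comment> \<open>At 0 the upper index is the natural number \<open>a - 1\<close>. It is smaller
      than the lower index when \<open>i \<le> j\<close>, and equal to it on the subdiagonal, where
      the entry is therefore 1.\<close>
    have diag: "coeff (?e i j) 0 = 0" if "i \<le> j" "j < k" for i j
      using a[of i j] that by (simp add: coeff_0_binom_entry)
    \<comment> \<open>Row 0 is divided by the variable. The linear coefficient then becomes a value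
      at 0, which can be taken entry by entry.\<close>
    define f where "f j = poly_shift 1 (?e 0 j)" for j
    have f: "?e 0 j = [:0, 1:] * f j" if "j < k" for j
      using diag[of 0 j] that
      by (intro poly_eqI) (auto simp: f_def coeff_poly_shift coeff_pCons split: nat.split)
    have fc: "coeff (f j) 0 = coeff (?e 0 j) 1" for j
      by (simp add: f_def coeff_poly_shift)
    have "skew_poly k p q = det_fun k (?e(0 := (\<lambda>j. [:0, 1:] * f j)))"
      unfolding skew_poly_def by (rule det_fun_cong) (use f in auto)
    also have "\<dots> = [:0, 1:] * det_fun k (?e(0 := f))"
    proof -
      have "(\<Prod>i = 0..<k. (?e(0 := (\<lambda>j. [:0, 1:] * f j))) i (s i))
          = [:0, 1:] * (\<Prod>i = 0..<k. (?e(0 := f)) i (s i))" for s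
        using conn(1) by (subst (1 2) prod.remove[of _ "0::nat"]) (auto simp: mult_ac intro!: prod.cong)
      then show ?thesis
        unfolding det_fun_leibniz by (simp add: sum_distrib_left mult_ac)
    qed
    finally have eq: "skew_poly k p q = [:0, 1:] * det_fun k (?e(0 := f))" .
    have "coeff (skew_poly k p q) 1 = coeff (det_fun k (?e(0 := f))) 0"
      unfolding eq by (simp add: coeff_pCons)
    also have "\<dots> = det_fun k (\<lambda>i j. coeff ((?e(0 := f)) i j) 0)"
      by (simp only: poly_0_coeff_0[symmetric] poly_det_fun)
    also have "\<dots> = (- 1) ^ (k - 1) * coeff (f (k - 1)) 0"
    proof (subst det_fun_strictly_lower[OF conn(1)])
      fix i assume "Suc i < k"
      then show "coeff ((?e(0 := f)) (Suc i) i) 0 = 1"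
        using a[of "Suc i" i] by (simp add: coeff_0_binom_entry)
    qed (use diag in auto)
    also have "\<dots> = (- 1) ^ (k - 1) * coeff (binom_entry (int (q 0) - int (p (k - 1))) (int (k - 1))) 1"
      by (simp add: fc)
    also have "\<dots> \<ge> 0"
      by (rule coeff_1_binom_entry_sign) (use a[of 0 "k - 1"] conn(1) in auto)
    finally have "coeff (skew_poly k p q) 1 \<ge> 0" .
    moreover have "coeff (skew_poly k p q) 0 = 0" unfolding eq by simp
    ultimately show ?thesis by simp
  qed
qed

section \<open>Nonnegativity of all coefficients\<close>

lemma poly_eq_on_nats:
  fixes p q :: "real poly"
  assumes "\<And>n::nat. poly p (real n) = poly q (real n)"
  shows "p = q"
proof -
  have "{x. poly (p - q) x = 0} \<supseteq> range real" using assms by auto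
  moreover have "infinite (range real)" by (simp add: range_inj_infinite)
  ultimately have "infinite {x. poly (p - q) x = 0}" using finite_subset by blast
  then show ?thesis using poly_roots_finite[of "p - q"] by auto
qed

text \<open>The derivative at \<open>s = 0\<close> of the convolution identity.\<close>

lemma pderiv_skew_poly:
  assumes "p \<in> partitions k" "q \<in> partitions k"
  shows "pderiv (skew_poly k p q)
    = (\<Sum>\<nu>\<in>below k q. Polynomial.smult (coeff (skew_poly k p \<nu>) 1) (skew_poly k \<nu> q))"
proof (rule poly_eq_on_nats)
  fix n
  let ?r = "(\<Sum>\<nu>\<in>below k q. Polynomial.smult (poly (skew_poly k \<nu> q) (real n)) (skew_poly k p \<nu>))"
  \<comment> \<open>With \<open>n\<close> fixed, both sides are polynomials in the real variable
    \<open>s\<close>.\<close>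
  have "poly (pcompose (skew_poly k p q) [:real n, 1:]) s = poly ?r s" for s
    using poly_skew_poly_add[OF assms order_refl assms(2), of s n]
    by (simp add: poly_pcompose poly_sum mult_ac add_ac)
  then have "pcompose (skew_poly k p q) [:real n, 1:] = ?r"
    by (simp add: poly_eq_poly_eq_iff[symmetric] fun_eq_iff)
  then have "poly (pderiv (pcompose (skew_poly k p q) [:real n, 1:])) 0 = poly (pderiv ?r) 0"
    by simp
  then show "poly (pderiv (skew_poly k p q)) (real n)
      = poly (\<Sum>\<nu>\<in>below k q. Polynomial.smult (coeff (skew_poly k p \<nu>) 1) (skew_poly k \<nu> q)) (real n)"
    by (simp add: pderiv_pcompose poly_pcompose pderiv_pCons higher_pderiv_sum[of 1, simplified] pderiv_smult poly_sum
        poly_0_coeff_0 coeff_sum coeff_pderiv mult_ac)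
qed

text \<open>Coefficients of positive degree are read off the derivative. In
  \<open>pderiv_skew_poly\<close> the terms with \<nu> not above \<open>p\<close> and the term \<nu>
  = p vanish, and the others belong to fewer partitions between \<nu> and \<open>q\<close>.\<close>

lemma skew_poly_nonneg:
  assumes "p \<in> partitions k" "q \<in> partitions k"
  shows "coeff (skew_poly k p q) d \<ge> 0"
  using assms(1)
proof (induction "card {r \<in> below k q. p \<le> r}" arbitrary: p d rule: less_induct)
  case less
  show ?case
  proof (cases "p \<le> q")
    case False
    then show ?thesis using skew_poly_eq_0[OF less.prems assms(2)] by simp
  next
    case True
    have anti: "antimono r" if "r \<in> partitions k" for r using that by (simp add: partitions_def)
    have low: "coeff (skew_poly k p r) 0 \<ge> 0 \<and> coeff (skew_poly k p r) 1 \<ge> 0"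
      if "r \<in> partitions k" "p \<le> r" for r
      by (rule coeff_skew_poly_nonneg) (use that anti less.prems in auto)
    have term_nonneg: "coeff (skew_poly k p \<nu>) 1 * coeff (skew_poly k \<nu> q) d' \<ge> 0" if \<nu>: "\<nu> \<in> below k q" for \<nu> d'
    proof -
      have \<nu>p: "\<nu> \<in> partitions k" "\<nu> \<le> q" using \<nu> by (auto simp: below_def)
      consider "\<not> p \<le> \<nu>" | "\<nu> = p" | "p \<le> \<nu>" "\<nu> \<noteq> p" by blast
      then show ?thesis
      proof cases
        case 1
        then show ?thesis using skew_poly_eq_0[OF less.prems \<nu>p(1)] by simp
      next
        case 2
        \<comment> \<open>In \<open>sum_skew_poly\<close> for \<open>q = p\<close> only the summand
          at \<open>p\<close> survives, so the value at \<open>n + 1\<close> equals the value at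
          \<open>n\<close>.\<close>
        have "poly (skew_poly k p p) (real n) = poly 1 (real n)" for n
        proof (induction n)
          case (Suc n)
          have "(\<Sum>\<nu>\<in>below k p. poly (skew_poly k p \<nu>) (real n))
              = (\<Sum>\<nu>\<in>below k p. if \<nu> = p then poly (skew_poly k p p) (real n) else 0)"
            by (rule sum.cong[OF refl])
               (use less.prems skew_poly_eq_0[OF less.prems] in \<open>auto simp: below_def\<close>)
          then have "poly (skew_poly k p p) (real n + 1) = poly (skew_poly k p p) (real n)"
            using finite_below[OF less.prems] less.prems
            by (simp add: sum_skew_poly[OF less.prems, symmetric] below_def)
          then show ?case using Suc by (simp add: add.commute)
        qed (simp add: poly_skew_poly_0 less.prems)
        then have "skew_poly k p p = 1" by (rule poly_eq_on_nats)
        then show ?thesis using 2 by simp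
      next
        case 3
        have "{r \<in> below k q. \<nu> \<le> r} \<subseteq> {r \<in> below k q. p \<le> r}"
          "p \<in> {r \<in> below k q. p \<le> r}" "p \<notin> {r \<in> below k q. \<nu> \<le> r}"
          using 3 True less.prems by (auto simp: below_def)
        then have "{r \<in> below k q. \<nu> \<le> r} \<subset> {r \<in> below k q. p \<le> r}" by blast
        then have "card {r \<in> below k q. \<nu> \<le> r} < card {r \<in> below k q. p \<le> r}"
          using finite_below[OF assms(2)] by (intro psubset_card_mono) auto
        then have "coeff (skew_poly k \<nu> q) d' \<ge> 0" by (rule less.hyps) (rule \<nu>p)
        then show ?thesis using low[OF \<nu>p(1) 3(1)] by simp
      qed
    qed
    show ?thesis
    proof (cases d)
      case 0
      then show ?thesis using low[OF assms(2) True] by simp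
    next
      case (Suc d')
      have "of_nat (Suc d') * coeff (skew_poly k p q) (Suc d') = coeff (pderiv (skew_poly k p q)) d'"
        by (simp add: coeff_pderiv)
      also have "\<dots> \<ge> 0"
        unfolding pderiv_skew_poly[OF less.prems assms(2)] coeff_sum coeff_smult
        by (intro sum_nonneg term_nonneg)
      finally show ?thesis using Suc by (simp add: zero_le_mult_iff)
    qed
  qed
qed

section \<open>Counting monotone fillings of a rectangle\<close>

definition fillings :: "nat \<Rightarrow> nat \<Rightarrow> (nat \<Rightarrow> nat) \<Rightarrow> (nat \<Rightarrow> nat) \<Rightarrow> (nat \<times> nat \<Rightarrow> nat) set" where
  "fillings k m lo up = {x.
     (\<forall>i<k. \<forall>j<m. lo i \<le> x (i, j) \<and> x (i, j) \<le> up i) \<and>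
     (\<forall>i j. \<not> (i < k \<and> j < m) \<longrightarrow> x (i, j) = 0) \<and>
     (\<forall>i j i' j'. i \<le> i' \<longrightarrow> i' < k \<longrightarrow> j \<le> j' \<longrightarrow> j' < m \<longrightarrow> x (i, j) \<le> x (i', j'))}"

lemma fillings_outside: "x \<in> fillings k m lo up \<Longrightarrow> \<not> (i < k \<and> j < m) \<Longrightarrow> x (i, j) = 0"
  unfolding fillings_def by blast

lemma fillings_mono:
  "x \<in> fillings k m lo up \<Longrightarrow> i \<le> i' \<Longrightarrow> i' < k \<Longrightarrow> j \<le> j' \<Longrightarrow> j' < m \<Longrightarrow> x (i, j) \<le> x (i', j')"
  unfolding fillings_def by blast

lemma fillings_bounds:
  "x \<in> fillings k m lo up \<Longrightarrow> i < k \<Longrightarrow> j < m \<Longrightarrow> lo i \<le> x (i, j) \<and> x (i, j) \<le> up i"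
  by (simp add: fillings_def)

lemma finite_fillings: "finite (fillings k m lo up)"
proof (rule finite_subset)
  let ?B = "{x. \<forall>p. (p \<in> {..<k} \<times> {..<m} \<longrightarrow> x p \<in> {..\<Sum>i<k. up i}) \<and>
      (p \<notin> {..<k} \<times> {..<m} \<longrightarrow> x p = 0)}"
  have "up i \<le> (\<Sum>i<k. up i)" if "i < k" for i
    using that by (intro member_le_sum) auto
  then have "x (i, j) \<le> (\<Sum>i<k. up i)" if "x \<in> fillings k m lo up" "i < k" "j < m" for x i j
    using fillings_bounds[OF that] that(2) by (meson order_trans)
  then show "fillings k m lo up \<subseteq> ?B"
    by (auto simp: fillings_outside)
  show "finite ?B" by (rule finite_set_of_finite_funs) auto
qed

text \<open>The rows that must (\<open>b = up\<close>) or may (\<open>b = lo\<close>) contain an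
  entry at most \<open>s\<close>, taken in full: they bound the region of entries below
  \<open>s + 1\<close> from inside and from outside.\<close>

definition full_columns :: "nat \<Rightarrow> nat \<Rightarrow> (nat \<Rightarrow> nat) \<Rightarrow> nat \<Rightarrow> nat \<Rightarrow> nat" where
  "full_columns k m b s = (\<lambda>i. if i < k \<and> b i \<le> s then m else 0)"

lemma full_columns_partition: "mono b \<Longrightarrow> full_columns k m b s \<in> partitions k"
proof (rule partitionsI)
  fix i assume "mono b"
  then have "b i \<le> b (Suc i)" by (simp add: monoD)
  then show "full_columns k m b s (Suc i) \<le> full_columns k m b s i"
    by (simp add: full_columns_def)
qed (simp add: full_columns_def)

abbreviation rectangle :: "nat \<Rightarrow> nat \<Rightarrow> nat \<Rightarrow> nat" where
  "rectangle k m \<equiv> full_columns k m (\<lambda>_. 0) 0"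

abbreviation rectangle_partitions :: "nat \<Rightarrow> nat \<Rightarrow> (nat \<Rightarrow> nat) set" where
  "rectangle_partitions k m \<equiv> below k (rectangle k m)"

lemma rectangle_partition: "rectangle k m \<in> partitions k"
  by (rule full_columns_partition) (simp add: mono_def)

lemma full_columns_rectangle: "mono b \<Longrightarrow> full_columns k m b s \<in> rectangle_partitions k m"
  unfolding below_def by (auto simp: full_columns_partition) (auto simp: full_columns_def le_fun_def)

lemma rectangle_partitions_le: "p \<in> rectangle_partitions k m \<Longrightarrow> p i \<le> m"
  by (auto simp: below_def full_columns_def le_fun_def split: if_splits dest: spec[of _ i])

lemma below_rectangle: "q \<in> rectangle_partitions k m \<Longrightarrow> below k q = {p \<in> rectangle_partitions k m. p \<le> q}"
  by (auto simp: below_def)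

text \<open>A filling truncated at \<open>t\<close>: the entry \<open>t\<close> stands for any value of at least \<open>t\<close>, and
  the partition \<open>p\<close> is the region of the smaller entries.\<close>

definition truncated :: "nat \<Rightarrow> nat \<Rightarrow> (nat \<Rightarrow> nat) \<Rightarrow> (nat \<Rightarrow> nat) \<Rightarrow> nat \<Rightarrow> (nat \<Rightarrow> nat) \<Rightarrow> (nat \<times> nat \<Rightarrow> nat) set" where
  "truncated k m lo up t p = {x \<in> fillings k m (\<lambda>i. min (lo i) t) (\<lambda>i. min (up i) t).
     \<forall>i<k. \<forall>j<m. x (i, j) < t \<longleftrightarrow> j < p i}"

lemma initial_segment_nat:
  fixes P :: "nat \<Rightarrow> bool"
  assumes "\<And>i j. i \<le> j \<Longrightarrow> j < m \<Longrightarrow> P j \<Longrightarrow> P i"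
  shows "\<exists>c\<le>m. \<forall>j<m. P j \<longleftrightarrow> j < c"
proof -
  define c where "c = (LEAST j. j \<ge> m \<or> \<not> P j)"
  have "c \<ge> m \<or> \<not> P c" unfolding c_def by (rule LeastI[of _ m]) simp
  moreover have "c \<le> m" unfolding c_def by (rule Least_le) simp
  moreover have "P j" if "j < c" for j using not_less_Least[of j] that unfolding c_def by blast
  moreover have "j < c" if "j < m" "P j" for j
    using assms[of c j] \<open>c \<ge> m \<or> \<not> P c\<close> that by (cases "j < c") auto
  ultimately show ?thesis by auto
qed

text \<open>Monotonicity along a row makes the region an initial segment of it; monotonicity in the
  other direction makes the lengths of these segments decrease.\<close>

lemma truncated_shape_exists:
  assumes "x \<in> fillings k m lo up"
  shows "\<exists>p\<in>rectangle_partitions k m. \<forall>i<k. \<forall>j<m. x (i, j) < t \<longleftrightarrow> j < p i"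
proof -
  have "\<exists>c\<le>m. \<forall>j<m. x (i, j) < t \<longleftrightarrow> j < c" if "i < k" for i
  proof (rule initial_segment_nat)
    fix a b assume "a \<le> b" "b < m" "x (i, b) < t"
    then show "x (i, a) < t" using fillings_mono[OF assms order_refl that, of a b] by simp
  qed
  then obtain c where c: "\<And>i. i < k \<Longrightarrow> c i \<le> m" "\<And>i j. i < k \<Longrightarrow> j < m \<Longrightarrow> x (i, j) < t \<longleftrightarrow> j < c i"
    by metis
  define p where "p i = (if i < k then c i else 0)" for i
  have "p \<in> partitions k"
  proof (rule partitionsI)
    fix i show "p (Suc i) \<le> p i"
    proof (rule ccontr)
      assume "\<not> ?thesis"
      then have *: "Suc i < k" "c i < c (Suc i)" by (auto simp: p_def split: if_splits)
      then have "c i < m" using c(1)[of "Suc i"] by simp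
      then have "x (Suc i, c i) < t" "\<not> x (i, c i) < t" using c(2) * by auto
      then show False using fillings_mono[OF assms, of i "Suc i" "c i" "c i"] * \<open>c i < m\<close> by simp
    qed
  qed (simp add: p_def)
  then have "p \<in> rectangle_partitions k m"
    using c(1) by (auto simp: below_def p_def full_columns_def le_fun_def)
  then show ?thesis using c(2) by (intro bexI[of _ p]) (auto simp: p_def)
qed

lemma truncated_shape_le:
  assumes "p \<in> rectangle_partitions k m" "\<And>i j. i < k \<Longrightarrow> j < m \<Longrightarrow> j < p i \<Longrightarrow> j < q i"
  shows "p \<le> q"
proof (rule le_funI)
  fix i
  show "p i \<le> q i"
  proof (cases "i < k")
    case True
    show ?thesis
    proof (rule ccontr)
      assume "\<not> ?thesis"
      then show False
        using assms(2)[of i "q i"] True rectangle_partitions_le[OF assms(1), of i] by auto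
    qed
  qed (use assms(1) partitions_zero[of p k i] in \<open>auto simp: below_def\<close>)
qed

lemma truncated_disjoint:
  assumes "p \<in> rectangle_partitions k m" "q \<in> rectangle_partitions k m" "p \<noteq> q"
  shows "truncated k m lo up t p \<inter> truncated k m lo up t q = {}"
proof (rule ccontr)
  assume "\<not> ?thesis"
  then obtain x where x: "\<forall>i<k. \<forall>j<m. x (i, j) < t \<longleftrightarrow> j < p i" "\<forall>i<k. \<forall>j<m. x (i, j) < t \<longleftrightarrow> j < q i"
    by (auto simp: truncated_def)
  have "p \<le> q" by (rule truncated_shape_le[OF assms(1)]) (use x in blast)
  moreover have "q \<le> p" by (rule truncated_shape_le[OF assms(2)]) (use x in blast)
  ultimately show False using assms(3) by simp
qed

lemma finite_truncated: "finite (truncated k m lo up t p)"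
  unfolding truncated_def using finite_fillings by simp

lemma card_UN_truncated:
  assumes "S \<subseteq> rectangle_partitions k m"
  shows "card (\<Union>p\<in>S. truncated k m lo up t p) = (\<Sum>p\<in>S. card (truncated k m lo up t p))"
proof (rule card_UN_disjoint)
  show "finite S" using finite_subset[OF assms] finite_below[OF rectangle_partition] by blast
  show "\<forall>p\<in>S. \<forall>q\<in>S. p \<noteq> q \<longrightarrow> truncated k m lo up t p \<inter> truncated k m lo up t q = {}"
    using assms by (intro ballI impI truncated_disjoint) auto
qed (simp add: finite_truncated)

lemma card_fillings_truncated:
  "card (fillings k m (\<lambda>i. min (lo i) t) (\<lambda>i. min (up i) t))
     = (\<Sum>p\<in>rectangle_partitions k m. card (truncated k m lo up t p))"
proof -
  have "fillings k m (\<lambda>i. min (lo i) t) (\<lambda>i. min (up i) t)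
      = (\<Union>p\<in>rectangle_partitions k m. truncated k m lo up t p)"
  proof (intro equalityI subsetI)
    fix x assume x: "x \<in> fillings k m (\<lambda>i. min (lo i) t) (\<lambda>i. min (up i) t)"
    from truncated_shape_exists[OF x, of t] x
    show "x \<in> (\<Union>p\<in>rectangle_partitions k m. truncated k m lo up t p)"
      unfolding truncated_def by blast
  qed (auto simp: truncated_def)
  then show ?thesis using card_UN_truncated[OF order_refl] by simp
qed

lemma card_truncated_0:
  assumes "p \<in> rectangle_partitions k m"
  shows "card (truncated k m lo up 0 p) = (if p = (\<lambda>_. 0) then 1 else 0)"
proof -
  have "x = (\<lambda>_. 0)" if "x \<in> fillings k m (\<lambda>i. 0) (\<lambda>i. 0)" for x
  proof
    fix ij :: "nat \<times> nat"
    obtain i j where ij: "ij = (i, j)" by force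
    then show "x ij = 0"
      using fillings_bounds[OF that, of i j] fillings_outside[OF that, of i j]
      by (cases "i < k \<and> j < m") auto
  qed
  then have "fillings k m (\<lambda>i. 0) (\<lambda>i. 0) = {\<lambda>_. 0}" by (auto simp: fillings_def)
  then have eq: "truncated k m lo up 0 p = (if \<forall>i<k. \<forall>j<m. \<not> j < p i then {\<lambda>_. 0} else {})"
    by (auto simp: truncated_def)
  have "(\<forall>i<k. \<forall>j<m. \<not> j < p i) \<longleftrightarrow> p = (\<lambda>_. 0)"
  proof
    assume "\<forall>i<k. \<forall>j<m. \<not> j < p i"
    then have "p \<le> (\<lambda>_. 0)" by (intro truncated_shape_le[OF assms]) auto
    then show "p = (\<lambda>_. 0)" by (auto simp: le_fun_def)
  qed simp
  then show ?thesis using eq by simp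
qed

lemma truncated_Suc_bounds:
  assumes "x \<in> truncated k m lo up (Suc t) q" "q \<in> rectangle_partitions k m"
  shows "full_columns k m up t \<le> q" "q \<le> full_columns k m lo t"
proof -
  have x: "x \<in> fillings k m (\<lambda>i. min (lo i) (Suc t)) (\<lambda>i. min (up i) (Suc t))"
    and sh: "\<And>i j. i < k \<Longrightarrow> j < m \<Longrightarrow> x (i, j) < Suc t \<longleftrightarrow> j < q i"
    using assms(1) by (auto simp: truncated_def)
  show "full_columns k m up t \<le> q"
  proof (rule le_funI)
    fix i
    show "full_columns k m up t i \<le> q i"
    proof (cases "i < k \<and> up i \<le> t \<and> m > 0")
      case True
      then have "x (i, m - 1) < Suc t" using fillings_bounds[OF x, of i "m - 1"] by auto
      then show ?thesis using sh[of i "m - 1"] True by (simp add: full_columns_def)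
    qed (auto simp: full_columns_def)
  qed
  show "q \<le> full_columns k m lo t"
  proof (rule truncated_shape_le[OF assms(2)])
    fix i j assume ij: "i < k" "j < m" "j < q i"
    then have "x (i, j) < Suc t" using sh by blast
    then have "lo i \<le> t" using fillings_bounds[OF x ij(1,2)] by auto
    then show "j < full_columns k m lo t i" using ij by (simp add: full_columns_def)
  qed
qed

text \<open>The inverse of truncating at \<open>t\<close>: cells outside \<open>q\<close> become
  \<open>t + 1\<close>, while cells of \<open>q\<close> outside \<open>p\<close> keep
  \<open>t\<close>, now as an actual entry.\<close>

lemma truncated_Suc_fill:
  assumes y: "y \<in> truncated k m lo up t p" and "p \<le> q" and q: "q \<in> rectangle_partitions k m"
    and A: "full_columns k m up t \<le> q" and B: "q \<le> full_columns k m lo t"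
  shows "(\<lambda>(i, j). if i < k \<and> j < m \<and> q i \<le> j then Suc t else y (i, j)) \<in> truncated k m lo up (Suc t) q"
proof -
  have fy: "y \<in> fillings k m (\<lambda>i. min (lo i) t) (\<lambda>i. min (up i) t)"
    using y by (auto simp: truncated_def)
  have le: "y (i, j) \<le> t" if "i < k" "j < m" for i j
    using fillings_bounds[OF fy that] by auto
  have up: "\<not> up i \<le> t" if "i < k" "j < m" "q i \<le> j" for i j
    using le_funD[OF A, of i] that by (auto simp: full_columns_def)
  have lo: "lo i \<le> t" if "i < k" "j < q i" for i j
    using le_funD[OF B, of i] that by (auto simp: full_columns_def split: if_splits)
  have anti: "q i' \<le> q i" if "i \<le> i'" for i i'
    using q that partitions_antimono by (auto simp: below_def)
  show ?thesis
    unfolding truncated_def fillings_def mem_Collect_eq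
  proof (intro conjI allI impI, goal_cases)
    case (1 i j)
    then show ?case using fillings_bounds[OF fy 1] lo[of i j] by (auto simp: not_le)
  next
    case (2 i j)
    then show ?case using fillings_bounds[OF fy 2] up[of i j] by (auto simp: not_le)
  next
    case (3 i j)
    then show ?case using fillings_outside[OF fy 3] by auto
  next
    case (4 i j i' j')
    then show ?case
      using fillings_mono[OF fy 4] le[of i j] anti[OF 4(1)]
      by (cases "q i \<le> j"; cases "q i' \<le> j'") auto
  next
    case (5 i j)
    then show ?case using le[OF 5] by auto
  qed
qed

text \<open>Transfer step: once the region \<open>q\<close> at level \<open>t + 1\<close> respects
  the bounds, the filling is determined by its truncation at \<open>t\<close>, whose region may be
  any partition inside \<open>q\<close>.\<close>

lemma card_truncated_Suc:
  assumes q: "q \<in> rectangle_partitions k m"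
  shows "card (truncated k m lo up (Suc t) q)
    = (if full_columns k m up t \<le> q \<and> q \<le> full_columns k m lo t
       then \<Sum>p\<in>below k q. card (truncated k m lo up t p) else 0)"
proof (cases "full_columns k m up t \<le> q \<and> q \<le> full_columns k m lo t")
  case True
  define g where "g x = (\<lambda>ij. min (x ij) t)" for x :: "nat \<times> nat \<Rightarrow> nat"
  define h where "h y = (\<lambda>(i, j). if i < k \<and> j < m \<and> q i \<le> j then Suc t else y (i, j))"
    for y :: "nat \<times> nat \<Rightarrow> nat"
  have "bij_betw g (truncated k m lo up (Suc t) q) (\<Union>p\<in>below k q. truncated k m lo up t p)"
  proof (rule bij_betw_byWitness[where f' = h])
    show "\<forall>x\<in>truncated k m lo up (Suc t) q. h (g x) = x"
    proof (intro ballI ext)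
      fix x and ij :: "nat \<times> nat"
      assume "x \<in> truncated k m lo up (Suc t) q"
      then have x: "x \<in> fillings k m (\<lambda>i. min (lo i) (Suc t)) (\<lambda>i. min (up i) (Suc t))"
        and sh: "\<And>i j. i < k \<Longrightarrow> j < m \<Longrightarrow> x (i, j) < Suc t \<longleftrightarrow> j < q i"
        by (auto simp: truncated_def)
      obtain i j where ij: "ij = (i, j)" by force
      show "h (g x) ij = x ij"
      proof (cases "i < k \<and> j < m")
        case True
        then have "x (i, j) \<le> Suc t" "x (i, j) < Suc t \<longleftrightarrow> j < q i"
          using sh fillings_bounds[OF x, of i j] by auto
        then show ?thesis unfolding ij g_def h_def using True by (cases "j < q i") auto
      qed (use fillings_outside[OF x, of i j] ij in \<open>auto simp: g_def h_def\<close>)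
    qed
    show "\<forall>y\<in>(\<Union>p\<in>below k q. truncated k m lo up t p). g (h y) = y"
    proof (intro ballI ext)
      fix y and ij :: "nat \<times> nat"
      assume "y \<in> (\<Union>p\<in>below k q. truncated k m lo up t p)"
      then obtain p where p: "p \<le> q"
        and y: "y \<in> fillings k m (\<lambda>i. min (lo i) t) (\<lambda>i. min (up i) t)"
        and sh: "\<And>i j. i < k \<Longrightarrow> j < m \<Longrightarrow> y (i, j) < t \<longleftrightarrow> j < p i"
        by (auto simp: truncated_def below_def)
      obtain i j where ij: "ij = (i, j)" by force
      show "g (h y) ij = y ij"
      proof (cases "i < k \<and> j < m")
        case True
        then have "y (i, j) \<le> t" "y (i, j) < t \<longleftrightarrow> j < p i"
          using sh fillings_bounds[OF y, of i j] by auto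
        then show ?thesis unfolding ij g_def h_def using True le_funD[OF p, of i] by (cases "j < q i") auto
      qed (use fillings_outside[OF y, of i j] ij in \<open>auto simp: g_def h_def\<close>)
    qed
    show "g ` truncated k m lo up (Suc t) q \<subseteq> (\<Union>p\<in>below k q. truncated k m lo up t p)"
    proof (rule image_subsetI)
      fix x assume "x \<in> truncated k m lo up (Suc t) q"
      then have x: "x \<in> fillings k m (\<lambda>i. min (lo i) (Suc t)) (\<lambda>i. min (up i) (Suc t))"
        and sh: "\<And>i j. i < k \<Longrightarrow> j < m \<Longrightarrow> x (i, j) < Suc t \<longleftrightarrow> j < q i"
        by (auto simp: truncated_def)
      have gx: "g x \<in> fillings k m (\<lambda>i. min (lo i) t) (\<lambda>i. min (up i) t)"
        unfolding fillings_def mem_Collect_eq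
      proof (intro conjI allI impI, goal_cases)
        case (1 i j)
        then show ?case using fillings_bounds[OF x 1] by (auto simp: g_def)
      next
        case (2 i j)
        then show ?case using fillings_bounds[OF x 2] by (auto simp: g_def)
      next
        case (3 i j)
        then show ?case using fillings_outside[OF x 3] by (auto simp: g_def)
      next
        case (4 i j i' j')
        then show ?case using fillings_mono[OF x 4] by (auto simp: g_def)
      qed
      obtain p where p: "p \<in> rectangle_partitions k m"
        and psh: "\<forall>i<k. \<forall>j<m. g x (i, j) < t \<longleftrightarrow> j < p i"
        using truncated_shape_exists[OF gx, of t] by auto
      have "p \<le> q"
      proof (rule truncated_shape_le[OF p])
        fix i j assume ij: "i < k" "j < m" "j < p i"
        then have "g x (i, j) < t" using psh by blast
        then have "x (i, j) < t" by (auto simp: g_def min_less_iff_disj)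
        then show "j < q i" using sh[OF ij(1,2)] by simp
      qed
      then have "p \<in> below k q" using p by (simp add: below_def)
      then show "g x \<in> (\<Union>p\<in>below k q. truncated k m lo up t p)"
        using gx psh by (auto simp: truncated_def)
    qed
    show "h ` (\<Union>p\<in>below k q. truncated k m lo up t p) \<subseteq> truncated k m lo up (Suc t) q"
      using truncated_Suc_fill[OF _ _ q] True by (auto simp: below_def h_def)
  qed
  then have "card (truncated k m lo up (Suc t) q) = card (\<Union>p\<in>below k q. truncated k m lo up t p)"
    by (rule bij_betw_same_card)
  also have "\<dots> = (\<Sum>p\<in>below k q. card (truncated k m lo up t p))"
    by (rule card_UN_truncated) (use below_rectangle[OF q] in auto)
  finally show ?thesis using True by simp
next
  case False
  then have "truncated k m lo up (Suc t) q = {}"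
    using truncated_Suc_bounds[OF _ q] by blast
  then show ?thesis by (simp only: False if_False card.empty)
qed

section \<open>Blocks of levels and dilation\<close>

lemma sup_partitions:
  assumes "p \<in> partitions k" "q \<in> partitions k"
  shows "sup p q \<in> partitions k"
proof (rule partitionsI)
  fix i
  show "sup p q (Suc i) \<le> sup p q i"
    unfolding sup_fun_def by (intro sup_mono partitions_antimono[OF assms(1)] partitions_antimono[OF assms(2)]) auto
qed (simp add: partitions_zero[OF assms(1)] partitions_zero[OF assms(2)])

text \<open>In the first step \<open>p \<le> q\<close> and \<open>A \<le> q\<close> together mean
  \<open>sup p A \<le> q\<close>, which is the value of an order polynomial at 1. Every further step
  raises the argument by 1 through \<open>sum_skew_poly\<close>.\<close>

lemma card_truncated_block:
  assumes "mono up" "\<And>r. r \<le> g \<Longrightarrow> full_columns k m up (t + r) = A"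
    and "\<And>r. r \<le> g \<Longrightarrow> full_columns k m lo (t + r) = B"
    and "q \<in> rectangle_partitions k m"
  shows "real (card (truncated k m lo up (t + Suc g) q))
    = (if A \<le> q \<and> q \<le> B
       then \<Sum>p\<in>rectangle_partitions k m.
         real (card (truncated k m lo up t p)) * poly (skew_poly k (sup p A) q) (real (Suc g)) else 0)"
  using assms(2-4)
proof (induction g arbitrary: q)
  case (0 q)
  have A: "A \<in> partitions k" using full_columns_partition[OF assms(1), of k m t] 0(1)[of 0] by simp
  have q: "q \<in> partitions k" using 0 by (simp add: below_def)
  have "(\<Sum>p\<in>below k q. real (card (truncated k m lo up t p)))
      = (\<Sum>p\<in>rectangle_partitions k m.
         real (card (truncated k m lo up t p)) * poly (skew_poly k (sup p A) q) 1)" if "A \<le> q"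
    unfolding below_rectangle[OF 0(3)]
  proof (rule sum.mono_neutral_cong_left)
    show "\<forall>p\<in>rectangle_partitions k m - {p \<in> rectangle_partitions k m. p \<le> q}.
      real (card (truncated k m lo up t p)) * poly (skew_poly k (sup p A) q) 1 = 0"
      using that by (auto simp: poly_skew_poly_1 sup_partitions A q below_def)
  qed (use that finite_below[OF rectangle_partition] in
       \<open>auto simp: poly_skew_poly_1 sup_partitions A q below_def\<close>)
  note sum = this
  show ?case
  proof (cases "A \<le> q \<and> q \<le> B")
    case True
    then show ?thesis
      using sum card_truncated_Suc[OF 0(3), of lo up t] 0(1)[of 0] 0(2)[of 0] by simp
  next
    case False
    then have "card (truncated k m lo up (Suc t) q) = 0"
      using card_truncated_Suc[OF 0(3), of lo up t] 0(1)[of 0] 0(2)[of 0] by (simp only: add_0_right if_False le0)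
    then show ?thesis by (simp only: False if_False) simp
  qed
next
  case (Suc g q)
  have A: "A \<in> partitions k" using full_columns_partition[OF assms(1), of k m t] Suc.prems(1)[of 0] by simp
  have q: "q \<in> partitions k" using Suc.prems(3) by (simp add: below_def)
  let ?N = "\<lambda>p. real (card (truncated k m lo up t p))"
  let ?R = "rectangle_partitions k m"
  have "real (\<Sum>p\<in>below k q. card (truncated k m lo up (t + Suc g) p))
      = (\<Sum>p\<in>?R. ?N p * poly (skew_poly k (sup p A) q) (real (Suc (Suc g))))" if "A \<le> q" "q \<le> B"
  proof -
    have "real (\<Sum>p\<in>below k q. card (truncated k m lo up (t + Suc g) p))
        = (\<Sum>r\<in>below k q. \<Sum>p\<in>?R. ?N p * poly (skew_poly k (sup p A) r) (real (Suc g)))"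
      unfolding of_nat_sum
    proof (rule sum.cong[OF refl])
      fix r assume "r \<in> below k q"
      then have r: "r \<in> ?R" "r \<le> q" "r \<in> partitions k"
        using below_rectangle[OF Suc.prems(3)] by (auto simp: below_def)
      have "(\<Sum>p\<in>?R. ?N p * poly (skew_poly k (sup p A) r) (real (Suc g))) = 0" if "\<not> A \<le> r"
        using that by (intro sum.neutral) (auto simp: skew_poly_eq_0 sup_partitions A r below_def)
      moreover have "r \<le> B" using r(2) that(2) by simp
      ultimately show "real (card (truncated k m lo up (t + Suc g) r))
          = (\<Sum>p\<in>?R. ?N p * poly (skew_poly k (sup p A) r) (real (Suc g)))"
        using Suc.IH[OF Suc.prems(1,2) r(1)] by simp
    qed
    also have "\<dots> = (\<Sum>p\<in>?R. ?N p * (\<Sum>r\<in>below k q. poly (skew_poly k (sup p A) r) (real (Suc g))))"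
      by (subst sum.swap) (simp add: sum_distrib_left)
    also have "\<dots> = (\<Sum>p\<in>?R. ?N p * poly (skew_poly k (sup p A) q) (real (Suc (Suc g))))"
      by (simp add: sum_skew_poly[OF q] add_ac)
    finally show ?thesis .
  qed
  note sum = this
  have step: "card (truncated k m lo up (t + Suc (Suc g)) q) = (if A \<le> q \<and> q \<le> B
      then \<Sum>p\<in>below k q. card (truncated k m lo up (t + Suc g) p) else 0)"
    using card_truncated_Suc[OF Suc.prems(3), of lo up "t + Suc g"]
    unfolding Suc.prems(1,2)[OF order_refl] by simp
  show ?case
  proof (cases "A \<le> q \<and> q \<le> B")
    case True
    then show ?thesis using sum by (simp only: step simp_thms if_True)
  next
    case False
    then show ?thesis by (simp only: step False if_False of_nat_0)
  qed
qed

text \<open>No multiple \<open>n * lo i\<close> or \<open>n * up i\<close> lies strictly between \<open>n * s\<close> and \<open>n * Suc s\<close>, so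
  the \<open>n\<close> truncation steps between these levels amount to one order polynomial. The rows with
  \<open>up i \<le> s\<close> must be full after the first of these steps; adding them to \<open>p\<close> at once is what
  makes the polynomial appear at \<open>n\<close> and not at \<open>n - 1\<close>.\<close>

primrec shape_poly :: "nat \<Rightarrow> nat \<Rightarrow> (nat \<Rightarrow> nat) \<Rightarrow> (nat \<Rightarrow> nat) \<Rightarrow> nat \<Rightarrow> (nat \<Rightarrow> nat) \<Rightarrow> real poly" where
  "shape_poly k m lo up 0 q = (if q = (\<lambda>_. 0) then 1 else 0)"
| "shape_poly k m lo up (Suc s) q =
    (if full_columns k m up s \<le> q \<and> q \<le> full_columns k m lo s
     then \<Sum>p\<in>rectangle_partitions k m. shape_poly k m lo up s p * skew_poly k (sup p (full_columns k m up s)) q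
     else 0)"

lemma shape_poly_nonneg:
  assumes "mono up" "q \<in> rectangle_partitions k m"
  shows "coeff (shape_poly k m lo up s q) d \<ge> 0"
  using assms(2)
proof (induction s arbitrary: q d)
  case (Suc s)
  then show ?case
    using full_columns_partition[OF assms(1)]
    by (auto simp: coeff_sum coeff_mult below_def
        intro!: sum_nonneg mult_nonneg_nonneg skew_poly_nonneg sup_partitions)
qed auto

lemma card_truncated_multiple:
  assumes "mono up" "n > 0" "q \<in> rectangle_partitions k m"
  shows "real (card (truncated k m (\<lambda>i. n * lo i) (\<lambda>i. n * up i) (n * s) q))
    = poly (shape_poly k m lo up s q) (real n)"
  using assms(3)
proof (induction s arbitrary: q)
  case (Suc s)
  obtain g where g: "n = Suc g" using assms(2) by (cases n) auto
  have cols: "full_columns k m (\<lambda>i. n * b i) (n * s + r) = full_columns k m b s" if "r \<le> g" for b r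
  proof -
    have "n * b i \<le> n * s + r \<longleftrightarrow> b i \<le> s" for i
    proof
      assume "n * b i \<le> n * s + r"
      also have "\<dots> < n * Suc s" using that g by simp
      finally have "b i < Suc s" by (simp only: mult_less_cancel1)
      then show "b i \<le> s" by simp
    qed (simp add: trans_le_add1)
    then show ?thesis by (simp add: full_columns_def)
  qed
  have "mono (\<lambda>i. n * up i)" using assms(1) by (auto simp: mono_def)
  from card_truncated_block[OF this cols cols Suc.prems, where g = g]
  show ?case using Suc.IH by (simp add: g poly_sum add_ac)
qed (simp add: card_truncated_0)

text \<open>\<open>card_truncated_multiple\<close> needs \<open>n > 0\<close>; at 0 the recursion is
  evaluated directly. Order polynomials are Kronecker deltas there, and the full rows only grow with
  \<open>s\<close>, so exactly one shape survives each step.\<close>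

lemma poly_shape_poly_0:
  assumes "mono lo" "mono up" "\<And>i. i < k \<Longrightarrow> lo i \<le> up i" "q \<in> rectangle_partitions k m"
  shows "poly (shape_poly k m lo up s q) 0
    = (if q = (case s of 0 \<Rightarrow> (\<lambda>_. 0) | Suc r \<Rightarrow> full_columns k m up r) then 1 else 0)"
  using assms(4)
proof (induction s arbitrary: q)
  case (Suc s)
  let ?A = "full_columns k m up" and ?R = "rectangle_partitions k m"
  define c where "c = (case s of 0 \<Rightarrow> (\<lambda>_. 0) | Suc r \<Rightarrow> ?A r)"
  have part: "?A s \<in> partitions k" "q \<in> partitions k"
    using full_columns_partition[OF assms(2)] Suc.prems by (auto simp: below_def)
  have "c \<le> ?A s" by (auto simp: c_def full_columns_def le_fun_def split: nat.split)
  then have sup: "sup c (?A s) = ?A s" by (simp add: sup_absorb2)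
  have c: "c \<in> ?R"
    using full_columns_rectangle[OF assms(2)]
    by (auto simp: c_def below_def full_columns_def le_fun_def intro!: partitionsI split: nat.split)
  have "(\<Sum>p\<in>?R. poly (shape_poly k m lo up s p) 0 * poly (skew_poly k (sup p (?A s)) q) 0)
      = (\<Sum>p\<in>?R. if p = c then poly (skew_poly k (sup p (?A s)) q) 0 else 0)"
    using Suc.IH by (intro sum.cong) (auto simp: c_def)
  also have "\<dots> = (if ?A s = q then 1 else 0)"
    using c finite_below[OF rectangle_partition] by (simp add: sup poly_skew_poly_0 part)
  finally have "(\<Sum>p\<in>?R. poly (shape_poly k m lo up s p) 0 * poly (skew_poly k (sup p (?A s)) q) 0)
      = (if ?A s = q then 1 else 0)" .
  moreover have "?A s \<le> full_columns k m lo s"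
    using assms(3) by (auto simp: full_columns_def le_fun_def intro: order_trans)
  ultimately show ?case by (auto simp: poly_sum)
qed auto

lemma fillings_ehrhart:
  assumes "mono lo" "mono up" "\<And>i. i < k \<Longrightarrow> lo i \<le> up i"
  shows "\<exists>E. (\<forall>n. poly E (real n) = real (card (fillings k m (\<lambda>i. n * lo i) (\<lambda>i. n * up i))))
    \<and> (\<forall>d. 0 \<le> coeff E d)"
\<comment> \<open>The entries are at most \<open>n * up k\<close>, so truncation at this level
  changes nothing; the final region \<open>q\<close> is arbitrary.\<close>
proof (intro exI[of _ "\<Sum>q\<in>rectangle_partitions k m. shape_poly k m lo up (up k) q"] conjI allI)
  let ?R = "rectangle_partitions k m"
  fix n :: nat
  have card: "real (card (fillings k m (\<lambda>i. n * lo i) (\<lambda>i. n * up i)))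
      = (\<Sum>q\<in>?R. real (card (truncated k m (\<lambda>i. n * lo i) (\<lambda>i. n * up i) (n * up k) q)))"
  proof -
    have "min (n * lo i) (n * up k) = n * lo i" "min (n * up i) (n * up k) = n * up i" if "i < k" for i
    proof -
      have "up i \<le> up k" using monoD[OF assms(2), of i k] that by simp
      then show "min (n * lo i) (n * up k) = n * lo i" "min (n * up i) (n * up k) = n * up i"
        using assms(3)[OF that] by (auto intro!: min_absorb1 mult_le_mono2)
    qed
    then have "fillings k m (\<lambda>i. n * lo i) (\<lambda>i. n * up i)
        = fillings k m (\<lambda>i. min (n * lo i) (n * up k)) (\<lambda>i. min (n * up i) (n * up k))"
      by (simp add: fillings_def)
    then show ?thesis by (simp add: card_fillings_truncated)
  qed
  show "poly (\<Sum>q\<in>?R. shape_poly k m lo up (up k) q) (real n)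
      = real (card (fillings k m (\<lambda>i. n * lo i) (\<lambda>i. n * up i)))"
  proof (cases "n = 0")
    case False
    then show ?thesis
      unfolding card poly_sum using assms(2) by (intro sum.cong) (auto simp: card_truncated_multiple)
  next
    case True
    define c where "c = (case up k of 0 \<Rightarrow> (\<lambda>_. 0) | Suc r \<Rightarrow> full_columns k m up r)"
    have z: "(\<lambda>_. 0) \<in> ?R" by (auto simp: below_def le_fun_def intro!: partitionsI)
    have c: "c \<in> ?R"
      using full_columns_rectangle[OF assms(2)] z by (auto simp: c_def split: nat.split)
    have "poly (\<Sum>q\<in>?R. shape_poly k m lo up (up k) q) 0 = (\<Sum>q\<in>?R. if q = c then 1 else 0)"
      unfolding poly_sum c_def by (intro sum.cong refl poly_shape_poly_0 assms)
    then show ?thesis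
      unfolding card using True c z finite_below[OF rectangle_partition]
      by (simp add: card_truncated_0 of_nat_sum[symmetric] del: of_nat_sum cong: sum.cong)
  qed
next
  fix d
  show "0 \<le> coeff (\<Sum>q\<in>rectangle_partitions k m. shape_poly k m lo up (up k) q) d"
    unfolding coeff_sum by (intro sum_nonneg shape_poly_nonneg assms)
qed

section \<open>Lattice polytopes closed under rounding\<close>

lemma lookup_scaleR: "Poly_Mapping.lookup (r *\<^sub>R x) i = r *\<^sub>R Poly_Mapping.lookup x i"
proof -
  have "finite {i. r *\<^sub>R Poly_Mapping.lookup x i \<noteq> 0}"
    by (rule finite_subset[OF _ finite_lookup[of x]]) auto
  then show ?thesis by (simp add: scaleR_poly_mapping_def lookup_Abs_poly_mapping)
qed

lemma mono_floor_frac: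
  fixes g :: "real \<Rightarrow> real"
  assumes "\<And>s t. 0 \<le> s \<Longrightarrow> s \<le> t \<Longrightarrow> t < 1 \<Longrightarrow> g s \<le> g t" "\<And>s. 0 \<le> s \<Longrightarrow> s < 1 \<Longrightarrow> 0 \<le> g s \<and> g s \<le> 1"
  shows "mono (\<lambda>r. of_int \<lfloor>r\<rfloor> + g (frac r))"
proof (rule monoI)
  fix r s :: real assume rs: "r \<le> s"
  show "of_int \<lfloor>r\<rfloor> + g (frac r) \<le> of_int \<lfloor>s\<rfloor> + g (frac s)"
  proof (cases "\<lfloor>r\<rfloor> = \<lfloor>s\<rfloor>")
    case True
    then have "frac r \<le> frac s" using rs by (simp add: frac_def)
    then show ?thesis using True assms(1)[of "frac r" "frac s"] by (simp add: frac_lt_1)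
  next
    case False
    then have "\<lfloor>r\<rfloor> + 1 \<le> \<lfloor>s\<rfloor>" using floor_mono[OF rs] by simp
    then have "real_of_int \<lfloor>r\<rfloor> + 1 \<le> real_of_int \<lfloor>s\<rfloor>" by linarith
    moreover have "g (frac r) \<le> 1" "0 \<le> g (frac s)" using assms(2) by (auto simp: frac_lt_1)
    ultimately show ?thesis by linarith
  qed
qed

text \<open>The closure condition holds for comparisons of coordinates and for integer bounds. The
  proof is by induction on the number of distinct nonzero fractional parts: the largest one is moved
  up to the next integer or down to the next smaller one, and the point lies on the segment between
  the two results.\<close>

lemma lattice_polytopeI:
  fixes Q :: "('i \<Rightarrow>\<^sub>0 real) set"
  assumes "finite I" "\<And>x. x \<in> Q \<Longrightarrow> Poly_Mapping.keys x \<subseteq> I"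
    and bound: "\<And>x i. x \<in> Q \<Longrightarrow> \<bar>Poly_Mapping.lookup x i\<bar> \<le> c"
    and "convex Q"
    and closed: "\<And>f x. mono f \<Longrightarrow> (\<And>n. f (of_int n) = of_int n) \<Longrightarrow> x \<in> Q \<Longrightarrow> Poly_Mapping.map f x \<in> Q"
  shows "lattice_polytope Q"
proof -
  define V where "V = Q \<inter> integer_lattice"
  have "finite V"
  proof (rule finite_imageD)
    let ?B = "{f. \<forall>i. (i \<in> I \<longrightarrow> f i \<in> {r. r \<in> \<int> \<and> \<bar>r\<bar> \<le> c}) \<and> (i \<notin> I \<longrightarrow> f i = 0)}"
    have "Poly_Mapping.lookup x i = 0" if "x \<in> Q" "i \<notin> I" for x i
      using assms(2)[OF that(1)] that(2) by (metis in_keys_iff subsetD)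
    then have "Poly_Mapping.lookup ` V \<subseteq> ?B"
      using bound by (auto simp: V_def integer_lattice_def)
    moreover have "finite ?B"
      by (rule finite_set_of_finite_funs[OF assms(1)]) (rule finite_abs_int_segment)
    ultimately show "finite (Poly_Mapping.lookup ` V)" by (rule finite_subset)
    show "inj_on Poly_Mapping.lookup V"
      by (rule inj_onI) (simp only: poly_mapping.lookup_inject)
  qed
  define F where "F x = frac ` range (Poly_Mapping.lookup x) - {0}" for x :: "'i \<Rightarrow>\<^sub>0 real"
  have lookup_map: "Poly_Mapping.lookup (Poly_Mapping.map f x) i = f (Poly_Mapping.lookup x i)"
    if "f 0 = 0" for f :: "real \<Rightarrow> real" and x :: "'i \<Rightarrow>\<^sub>0 real" and i
    using that by (simp add: Poly_Mapping.map.rep_eq when_def)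
  have fin: "finite (F x)" for x
  proof (rule finite_subset)
    show "F x \<subseteq> frac ` Poly_Mapping.lookup x ` Poly_Mapping.keys x"
      by (auto simp: F_def in_keys_iff intro!: imageI)
  qed simp
  have F_sub: "F x \<subseteq> S" if "\<And>i. frac (Poly_Mapping.lookup x i) \<in> insert 0 S" for x S
    using that unfolding F_def by blast
  have hull: "x \<in> convex hull V" if "x \<in> Q" for x
    using that
  proof (induction "card (F x)" arbitrary: x rule: less_induct)
    case less
    show ?case
    proof (cases "F x = {}")
      case True
      have "frac (Poly_Mapping.lookup x i) = 0" for i
      proof (rule ccontr)
        assume "\<not> ?thesis"
        then have "frac (Poly_Mapping.lookup x i) \<in> F x"
          unfolding F_def by (intro DiffI imageI rangeI) simp
        then show False using True by simp
      qed
      then have "x \<in> V" using less.prems by (auto simp: V_def integer_lattice_def frac_eq_0_iff)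
      then show ?thesis by (rule hull_inc)
    next
      case False
      \<comment> \<open>The two largest fractional parts, with 0 as the second if there is only
        one.\<close>
      define a where "a = Max (F x)"
      define b where "b = Max (insert 0 (F x - {a}))"
      have aF: "a \<in> F x" and a_max: "\<And>r. r \<in> F x \<Longrightarrow> r \<le> a"
        using False fin by (auto simp: a_def)
      obtain i0 where "a = frac (Poly_Mapping.lookup x i0)" "a \<noteq> 0"
        using aF unfolding F_def by blast
      then have a: "0 < a" "a < 1"
        using frac_ge_0[of "Poly_Mapping.lookup x i0"] frac_lt_1[of "Poly_Mapping.lookup x i0"]
        by (auto simp only: order_less_le)
      have bF: "b \<in> insert 0 (F x - {a})" and b_max: "\<And>r. r \<in> insert 0 (F x - {a}) \<Longrightarrow> r \<le> b"
        unfolding b_def using fin by (intro Max_in; simp) (intro Max_ge; simp add: fin)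
      have b: "0 \<le> b" "b < a"
        using b_max[of 0] bF a a_max[of b] by (auto simp: order_less_le)
      define up dn where "up r = of_int \<lfloor>r\<rfloor> + (if a \<le> frac r then 1 else frac r)"
        and "dn r = of_int \<lfloor>r\<rfloor> + min (frac r) b" for r :: real
      have "mono up" unfolding up_def by (rule mono_floor_frac) auto
      have "mono dn" unfolding dn_def by (rule mono_floor_frac) (use b in auto)
      have up_int: "up (of_int n) = of_int n" and dn_int: "dn (of_int n) = of_int n" for n
        using a b by (auto simp: up_def dn_def)
      define x1 x2 where "x1 = Poly_Mapping.map up x" and "x2 = Poly_Mapping.map dn x"
      have l1: "Poly_Mapping.lookup x1 i = up (Poly_Mapping.lookup x i)"
        and l2: "Poly_Mapping.lookup x2 i = dn (Poly_Mapping.lookup x i)" for i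
        unfolding x1_def x2_def using up_int[of 0] dn_int[of 0] by (auto intro!: lookup_map)
      have cases: "frac (Poly_Mapping.lookup x i) = a
          \<or> (frac (Poly_Mapping.lookup x i) \<in> insert 0 (F x - {a}) \<and> frac (Poly_Mapping.lookup x i) \<le> b)" for i
      proof -
        have "frac (Poly_Mapping.lookup x i) \<in> insert 0 (F x)" by (auto simp: F_def)
        then show ?thesis using b_max by blast
      qed
      have frac_add: "frac (of_int n + s) = s" if "0 \<le> s" "s < 1" for n and s :: real
        using that by (simp add: frac_unique_iff) 
      have "frac (up (Poly_Mapping.lookup x i)) \<in> insert 0 (F x - {a})" for i
        using cases[of i] b a by (auto simp: up_def frac_add frac_lt_1)
      then have F1: "F x1 \<subseteq> F x - {a}" by (intro F_sub) (simp only: l1)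
      have "frac (dn (Poly_Mapping.lookup x i)) \<in> insert 0 (F x - {a})" for i
      proof -
        have "frac (dn (Poly_Mapping.lookup x i)) = min (frac (Poly_Mapping.lookup x i)) b"
          unfolding dn_def using a b by (intro frac_add) auto
        then show ?thesis
          using cases[of i] bF b by (metis less_imp_le min.absorb1 min.absorb2)
      qed
      then have F2: "F x2 \<subseteq> F x - {a}" by (intro F_sub) (simp only: l2)
      have lt: "card S < card (F x)" if "S \<subseteq> F x - {a}" for S
        using that aF fin by (intro psubset_card_mono) auto
      have "x1 \<in> convex hull V" "x2 \<in> convex hull V"
        using less.hyps[OF lt[OF F1]] less.hyps[OF lt[OF F2]]
          closed[OF \<open>mono up\<close> up_int less.prems] closed[OF \<open>mono dn\<close> dn_int less.prems]
        unfolding x1_def x2_def by auto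
      \<comment> \<open>The weights solve \<open>a = u * 1 + (1 - u) * b\<close>; coordinates with a
        smaller fractional part are fixed by both maps.\<close>
      moreover have "x = ((a - b) / (1 - b)) *\<^sub>R x1 + ((1 - a) / (1 - b)) *\<^sub>R x2"
      proof (rule poly_mapping_eqI)
        fix i
        define r where "r = Poly_Mapping.lookup x i"
        have "(a - b) / (1 - b) * up r + (1 - a) / (1 - b) * dn r = r"
        proof -
          have "(a - b) * up r + (1 - a) * dn r = (1 - b) * r"
          proof (cases "frac r = a")
            case True
            then have eq: "up r = of_int \<lfloor>r\<rfloor> + 1" "dn r = of_int \<lfloor>r\<rfloor> + b" "of_int \<lfloor>r\<rfloor> + a = r"
              using b by (auto simp: up_def dn_def frac_def)
            have "(a - b) * up r + (1 - a) * dn r = (1 - b) * (of_int \<lfloor>r\<rfloor> + a)"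
              unfolding eq(1,2) by (simp add: algebra_simps)
            then show ?thesis unfolding eq(3) .
          next
            case False
            then have "frac r \<le> b" using cases[of i] by (simp add: r_def)
            then have "up r = r" "dn r = r" using b by (auto simp: up_def dn_def frac_def)
            then show ?thesis by (simp add: algebra_simps)
          qed
          then have "((a - b) * up r + (1 - a) * dn r) / (1 - b) = r" using a b by simp
          then show ?thesis by (simp add: add_divide_distrib)
        qed
        then show "Poly_Mapping.lookup x i
            = Poly_Mapping.lookup (((a - b) / (1 - b)) *\<^sub>R x1 + ((1 - a) / (1 - b)) *\<^sub>R x2) i"
          by (simp add: lookup_add lookup_scaleR l1 l2 r_def)
      qed
      moreover have "(a - b) / (1 - b) + (1 - a) / (1 - b) = 1"
        using a b by (simp flip: add_divide_distrib)
      moreover have "(a - b) / (1 - b) \<ge> 0" "(1 - a) / (1 - b) \<ge> 0"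
        using a b by (auto intro!: divide_nonneg_nonneg)
      ultimately show ?thesis
        using convexD[OF convex_convex_hull[of V]] by metis
    qed
  qed
  have "convex hull V \<subseteq> Q" by (rule hull_minimal) (auto simp: V_def assms)
  then have "Q = convex hull V" using hull by auto
  then show ?thesis unfolding lattice_polytope_def using \<open>finite V\<close> by (auto simp: V_def)
qed

section \<open>Pitman--Stanley polytopes\<close>

text \<open>With arbitrary real bounds the family is closed under positive dilation.\<close>

definition ps_polytope :: "nat \<Rightarrow> nat \<Rightarrow> (nat \<Rightarrow> real) \<Rightarrow> (nat \<Rightarrow> real) \<Rightarrow> (nat \<times> nat \<Rightarrow>\<^sub>0 real) set" where
  "ps_polytope k m lo up =
     {x. Poly_Mapping.keys x \<subseteq> {1..k} \<times> {1..m} \<and>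
         (\<forall>i\<in>{1..k}.
            lo i \<le> Poly_Mapping.lookup x (i, 1) \<and>
            (\<forall>j\<in>{1..<m}. Poly_Mapping.lookup x (i, j) \<le> Poly_Mapping.lookup x (i, j + 1)) \<and>
            Poly_Mapping.lookup x (i, m) \<le> up i) \<and>
         (\<forall>i\<in>{1..<k}. \<forall>j\<in>{1..m}.
            Poly_Mapping.lookup x (i, j) \<le> Poly_Mapping.lookup x (i + 1, j))}"

lemma pitman_stanley_ps:
  "pitman_stanley k m y z = ps_polytope k m (\<lambda>i. real (partial_sum z i)) (\<lambda>i. real (partial_sum y i))"
  by (simp add: pitman_stanley_def ps_polytope_def)

lemma ps_mono:
  assumes x: "x \<in> ps_polytope k m lo up" and "1 \<le> i" "i \<le> i'" "i' \<le> k" "1 \<le> j" "j \<le> j'" "j' \<le> m"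
  shows "Poly_Mapping.lookup x (i, j) \<le> Poly_Mapping.lookup x (i', j')"
proof -
  have "Poly_Mapping.lookup x (i, j) \<le> Poly_Mapping.lookup x (i', j)"
    using assms(3,4)
  proof (induction i' rule: dec_induct)
    case (step n)
    then have "Poly_Mapping.lookup x (n, j) \<le> Poly_Mapping.lookup x (n + 1, j)"
      using x assms(2,5-7) by (auto simp: ps_polytope_def)
    then show ?case using step by simp
  qed simp
  also have "\<dots> \<le> Poly_Mapping.lookup x (i', j')"
    using assms(6,7)
  proof (induction j' rule: dec_induct)
    case (step n)
    then have "Poly_Mapping.lookup x (i', n) \<le> Poly_Mapping.lookup x (i', n + 1)"
      using x assms(2-5) by (auto simp: ps_polytope_def)
    then show ?case using step by simp
  qed simp
  finally show ?thesis .
qed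

lemma ps_bounds:
  assumes x: "x \<in> ps_polytope k m lo up" and "1 \<le> i" "i \<le> k" "1 \<le> j" "j \<le> m"
  shows "lo i \<le> Poly_Mapping.lookup x (i, j)" "Poly_Mapping.lookup x (i, j) \<le> up i"
proof -
  have "lo i \<le> Poly_Mapping.lookup x (i, 1)" "Poly_Mapping.lookup x (i, m) \<le> up i"
    using assms by (auto simp: ps_polytope_def)
  then show "lo i \<le> Poly_Mapping.lookup x (i, j)" "Poly_Mapping.lookup x (i, j) \<le> up i"
    using ps_mono[OF x, of i i 1 j] ps_mono[OF x, of i i j m] assms by auto
qed

lemma ps_outside:
  assumes "x \<in> ps_polytope k m lo up" "\<not> (1 \<le> i \<and> i \<le> k \<and> 1 \<le> j \<and> j \<le> m)"
  shows "Poly_Mapping.lookup x (i, j) = 0"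
proof (rule ccontr)
  assume "\<not> ?thesis"
  then have "(i, j) \<in> Poly_Mapping.keys x" by (simp add: in_keys_iff)
  then show False using assms by (auto simp: ps_polytope_def)
qed

lemma convex_ps: "convex (ps_polytope k m lo up)"
proof (rule convexI)
  fix x x' :: "nat \<times> nat \<Rightarrow>\<^sub>0 real" and u v :: real
  assume x: "x \<in> ps_polytope k m lo up" and x': "x' \<in> ps_polytope k m lo up" and uv: "0 \<le> u" "0 \<le> v" "u + v = 1"
  have le: "u * a + v * b \<le> u * c + v * d" if "a \<le> c" "b \<le> d" for a b c d
    using that uv by (intro add_mono mult_left_mono) auto
  have const: "u * c + v * c = c" for c using uv by (simp flip: distrib_right)
  have "Poly_Mapping.keys (u *\<^sub>R x + v *\<^sub>R x') \<subseteq> Poly_Mapping.keys x \<union> Poly_Mapping.keys x'"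
    by (auto simp: in_keys_iff lookup_add lookup_scaleR)
  then have keys: "Poly_Mapping.keys (u *\<^sub>R x + v *\<^sub>R x') \<subseteq> {1..k} \<times> {1..m}"
    using x x' unfolding ps_polytope_def by blast
  show "u *\<^sub>R x + v *\<^sub>R x' \<in> ps_polytope k m lo up"
    unfolding ps_polytope_def mem_Collect_eq lookup_add lookup_scaleR real_scaleR_def
  proof (intro conjI keys ballI)
    fix i assume i: "i \<in> {1..k}"
    show "lo i \<le> u * Poly_Mapping.lookup x (i, 1) + v * Poly_Mapping.lookup x' (i, 1)"
      by (subst const[of "lo i", symmetric], rule le) (use x x' i in \<open>auto simp: ps_polytope_def\<close>)
    show "u * Poly_Mapping.lookup x (i, m) + v * Poly_Mapping.lookup x' (i, m) \<le> up i"
      by (subst const[of "up i", symmetric], rule le) (use x x' i in \<open>auto simp: ps_polytope_def\<close>)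
  qed (rule le; use x x' in \<open>auto simp: ps_polytope_def\<close>)+
qed

lemma lattice_polytope_ps:
  fixes lo up :: "nat \<Rightarrow> int"
  assumes "m \<ge> 1"
  shows "lattice_polytope (ps_polytope k m (\<lambda>i. of_int (lo i)) (\<lambda>i. of_int (up i)))" (is "lattice_polytope ?Q")
proof (rule lattice_polytopeI)
  show "finite ({1..k} \<times> {1..m})" by simp
  show "Poly_Mapping.keys x \<subseteq> {1..k} \<times> {1..m}" if "x \<in> ?Q" for x
    using that by (simp add: ps_polytope_def)
  define c where "c = (\<Sum>i = 1..k. \<bar>real_of_int (lo i)\<bar> + \<bar>real_of_int (up i)\<bar>)"
  show "\<bar>Poly_Mapping.lookup x ij\<bar> \<le> c" if x: "x \<in> ?Q" for x ij
  proof -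
    obtain i j where ij: "ij = (i, j)" by force
    show ?thesis
    proof (cases "1 \<le> i \<and> i \<le> k \<and> 1 \<le> j \<and> j \<le> m")
      case True
      have "\<bar>real_of_int (lo i)\<bar> + \<bar>real_of_int (up i)\<bar> \<le> c"
        unfolding c_def using True by (intro member_le_sum) auto
      then show ?thesis using ps_bounds[OF x, of i j] True ij by auto
    next
      case False
      have "c \<ge> 0" by (simp add: c_def sum_nonneg)
      then show ?thesis using ps_outside[OF x False] ij by simp
    qed
  qed
  show "convex ?Q" by (rule convex_ps)
  show "Poly_Mapping.map f x \<in> ?Q"
    if f: "mono f" "\<And>n. f (of_int n) = of_int n" and x: "x \<in> ?Q" for f x
  proof -
    have lookup: "Poly_Mapping.lookup (Poly_Mapping.map f x) i = f (Poly_Mapping.lookup x i)" for i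
      using f(2)[of 0] by (simp add: Poly_Mapping.map.rep_eq when_def)
    have "Poly_Mapping.keys (Poly_Mapping.map f x) \<subseteq> Poly_Mapping.keys x"
      using f(2)[of 0] by (auto simp: in_keys_iff lookup)
    moreover have "of_int n \<le> f r" if "of_int n \<le> r" for n r using monoD[OF f(1) that] f(2)[of n] by simp
    moreover have "f r \<le> of_int n" if "r \<le> of_int n" for n r using monoD[OF f(1) that] f(2)[of n] by simp
    ultimately show ?thesis
      using x monoD[OF f(1)] unfolding ps_polytope_def mem_Collect_eq lookup by blast
  qed
qed

lemma ps_empty:
  assumes "m \<ge> 1" "i \<in> {1..k}" "up i < lo i"
  shows "ps_polytope k m lo up = {}"
  using ps_bounds[of _ k m lo up i 1] assms by fastforce

text \<open>For \<open>n = 0\<close> the right side is the single point 0 whatever the bounds,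
  whereas the image of the empty set is empty.\<close>

lemma scale_ps:
  assumes "n = 0 \<longrightarrow> ps_polytope k m lo up \<noteq> {}" "m \<ge> 1"
  shows "(\<lambda>x. real n *\<^sub>R x) ` ps_polytope k m lo up = ps_polytope k m (\<lambda>i. real n * lo i) (\<lambda>i. real n * up i)"
proof (cases "n = 0")
  case True
  have "x = 0" if "x \<in> ps_polytope k m (\<lambda>i. 0) (\<lambda>i. 0)" for x
  proof (rule poly_mapping_eqI)
    fix ij :: "nat \<times> nat"
    obtain i j where ij: "ij = (i, j)" by force
    show "Poly_Mapping.lookup x ij = Poly_Mapping.lookup 0 ij"
      using ps_bounds[OF that, of i j] ps_outside[OF that, of i j] ij
      by (cases "1 \<le> i \<and> i \<le> k \<and> 1 \<le> j \<and> j \<le> m") auto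
  qed
  then have "ps_polytope k m (\<lambda>i. 0) (\<lambda>i. 0) = {0}" by (auto simp: ps_polytope_def)
  then show ?thesis using True assms by auto
next
  case False
  have scale: "c *\<^sub>R x \<in> ps_polytope k m (\<lambda>i. c * lo i) (\<lambda>i. c * up i)" if "x \<in> ps_polytope k m lo up" "c > 0" for c x lo up
    using that by (auto simp: ps_polytope_def lookup_scaleR in_keys_iff subset_iff)
  show ?thesis
  proof
    show "(\<lambda>x. real n *\<^sub>R x) ` ps_polytope k m lo up \<subseteq> ps_polytope k m (\<lambda>i. real n * lo i) (\<lambda>i. real n * up i)"
      using scale False by auto
    show "ps_polytope k m (\<lambda>i. real n * lo i) (\<lambda>i. real n * up i) \<subseteq> (\<lambda>x. real n *\<^sub>R x) ` ps_polytope k m lo up"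
    proof
      fix x assume "x \<in> ps_polytope k m (\<lambda>i. real n * lo i) (\<lambda>i. real n * up i)"
      from scale[OF this, of "1 / real n"] have "(1 / real n) *\<^sub>R x \<in> ps_polytope k m lo up"
        using False by simp
      then show "x \<in> (\<lambda>x. real n *\<^sub>R x) ` ps_polytope k m lo up"
        using False by (intro image_eqI[of _ _ "(1 / real n) *\<^sub>R x"]) auto
    qed
  qed
qed


lemma card_ps_lattice:
  fixes lo up :: "nat \<Rightarrow> nat"
  assumes "m \<ge> 1"
  shows "card (ps_polytope k m (\<lambda>i. real (lo i)) (\<lambda>i. real (up i)) \<inter> integer_lattice)
    = card (fillings k m (\<lambda>i. lo (Suc i)) (\<lambda>i. up (Suc i)))" (is "card ?P = card ?F")
proof -
  define G where "G x = (\<lambda>(i, j). if i < k \<and> j < m then nat \<lfloor>Poly_Mapping.lookup x (Suc i, Suc j)\<rfloor> else 0)"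
    for x :: "nat \<times> nat \<Rightarrow>\<^sub>0 real"
  define H where "H w = Abs_poly_mapping
      (\<lambda>(i, j). if 1 \<le> i \<and> i \<le> k \<and> 1 \<le> j \<and> j \<le> m then real (w (i - 1, j - 1)) else 0)"
    for w :: "nat \<times> nat \<Rightarrow> nat"
  have H: "Poly_Mapping.lookup (H w) (i, j)
      = (if 1 \<le> i \<and> i \<le> k \<and> 1 \<le> j \<and> j \<le> m then real (w (i - 1, j - 1)) else 0)" for w i j
  proof -
    have "finite {ij. (case ij of (i, j) \<Rightarrow>
        if 1 \<le> i \<and> i \<le> k \<and> 1 \<le> j \<and> j \<le> m then real (w (i - 1, j - 1)) else 0) \<noteq> 0}"
      by (rule finite_subset[of _ "{1..k} \<times> {1..m}"]) (auto split: if_splits)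
    then show ?thesis by (simp add: H_def lookup_Abs_poly_mapping)
  qed
  \<comment> \<open>The lower bounds are natural numbers, so integral coordinates are nonnegative
    and the conversion loses nothing.\<close>
  have G: "real (G x (i, j)) = Poly_Mapping.lookup x (Suc i, Suc j)" if "x \<in> ?P" "i < k" "j < m" for x i j
  proof -
    have "Poly_Mapping.lookup x (Suc i, Suc j) \<in> \<int>" using that(1) by (simp add: integer_lattice_def)
    then obtain n where n: "Poly_Mapping.lookup x (Suc i, Suc j) = of_int n" by (elim Ints_cases)
    have "x \<in> ps_polytope k m (\<lambda>i. real (lo i)) (\<lambda>i. real (up i))" using that(1) by simp
    then have "real (lo (Suc i)) \<le> of_int n"
      using ps_bounds(1)[of x k m _ _ "Suc i" "Suc j"] that(2,3) unfolding n[symmetric] by fastforce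
    then have "n \<ge> 0" by linarith
    then show ?thesis using that(2,3) by (simp add: G_def n)
  qed
  have "bij_betw G ?P ?F"
  proof (rule bij_betw_byWitness[where f' = H])
    show "\<forall>x\<in>?P. H (G x) = x"
    proof (intro ballI poly_mapping_eqI)
      fix x and ij :: "nat \<times> nat"
      assume x: "x \<in> ?P"
      obtain i j where ij: "ij = (i, j)" by force
      show "Poly_Mapping.lookup (H (G x)) ij = Poly_Mapping.lookup x ij"
      proof (cases "1 \<le> i \<and> i \<le> k \<and> 1 \<le> j \<and> j \<le> m")
        case True
        then have "i - 1 < k" "j - 1 < m" by auto
        then show ?thesis using True G[OF x, of "i - 1" "j - 1"] by (simp add: ij H)
      next
        case False
        then have "Poly_Mapping.lookup x (i, j) = 0" using x by (intro ps_outside) auto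
        then show ?thesis using False by (auto simp: ij H)
      qed
    qed
    show "\<forall>w\<in>?F. G (H w) = w"
    proof (intro ballI ext)
      fix w and ij :: "nat \<times> nat"
      assume w: "w \<in> ?F"
      obtain i j where ij: "ij = (i, j)" by force
      show "G (H w) ij = w ij"
        using fillings_outside[OF w, of i j] by (cases "i < k \<and> j < m") (auto simp: ij G_def H)
    qed
    show "G ` ?P \<subseteq> ?F"
    proof (rule image_subsetI)
      fix x assume x: "x \<in> ?P"
      then have xp: "x \<in> ps_polytope k m (\<lambda>i. real (lo i)) (\<lambda>i. real (up i))" by simp
      show "G x \<in> ?F"
        unfolding fillings_def mem_Collect_eq
      proof (intro conjI allI impI, goal_cases)
        case (1 i j)
        then have "real (lo (Suc i)) \<le> real (G x (i, j))"
          unfolding G[OF x 1] by (intro ps_bounds(1)[OF xp]) auto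
        then show ?case by simp
      next
        case (2 i j)
        then have "real (G x (i, j)) \<le> real (up (Suc i))"
          unfolding G[OF x 2] by (intro ps_bounds(2)[OF xp]) auto
        then show ?case by simp
      next
        case (3 i j)
        then show ?case by (auto simp: G_def)
      next
        case (4 i j i' j')
        then have "real (G x (i, j)) \<le> real (G x (i', j'))"
          using ps_mono[OF xp, of "Suc i" "Suc i'" "Suc j" "Suc j'"] by (simp add: G[OF x])
        then show ?case by simp
      qed
    qed
    show "H ` ?F \<subseteq> ?P"
    proof (rule image_subsetI)
      fix w assume w: "w \<in> ?F"
      have "Poly_Mapping.lookup (H w) ij \<in> \<int>" for ij by (cases ij) (simp add: H)
      then have "H w \<in> integer_lattice" by (simp add: integer_lattice_def)
      moreover have "H w \<in> ps_polytope k m (\<lambda>i. real (lo i)) (\<lambda>i. real (up i))"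
        unfolding ps_polytope_def mem_Collect_eq
      proof (intro conjI ballI)
        show "Poly_Mapping.keys (H w) \<subseteq> {1..k} \<times> {1..m}"
          by (auto simp: in_keys_iff H split: if_splits)
      next
        fix i assume i: "i \<in> {1..k}"
        show "real (lo i) \<le> Poly_Mapping.lookup (H w) (i, 1)"
          using i assms fillings_bounds[OF w, of "i - 1" 0] by (auto simp: H)
        show "Poly_Mapping.lookup (H w) (i, m) \<le> real (up i)"
          using i assms fillings_bounds[OF w, of "i - 1" "m - 1"] by (auto simp: H)
        fix j assume "j \<in> {1..<m}"
        then show "Poly_Mapping.lookup (H w) (i, j) \<le> Poly_Mapping.lookup (H w) (i, j + 1)"
          using i fillings_mono[OF w, of "i - 1" "i - 1" "j - 1" j] by (auto simp: H)
      next
        fix i j assume "i \<in> {1..<k}" "j \<in> {1..m}"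
        then show "Poly_Mapping.lookup (H w) (i, j) \<le> Poly_Mapping.lookup (H w) (i + 1, j)"
          using fillings_mono[OF w, of "i - 1" i "j - 1" "j - 1"] by (auto simp: H)
      qed
      ultimately show "H w \<in> ?P" by simp
    qed
  qed
  then show ?thesis by (rule bij_betw_same_card)
qed

lemma ps_nonempty:
  fixes lo up :: "nat \<Rightarrow> nat"
  assumes "m \<ge> 1" "mono up" "\<And>i. i \<in> {1..k} \<Longrightarrow> lo i \<le> up i"
  shows "ps_polytope k m (\<lambda>i. real (lo i)) (\<lambda>i. real (up i)) \<noteq> {}"
proof -
  \<comment> \<open>The largest filling: every entry is the upper bound of its row.\<close>
  have "(\<lambda>(i, j). if i < k \<and> j < m then up (Suc i) else 0) \<in> fillings k m (\<lambda>i. lo (Suc i)) (\<lambda>i. up (Suc i))"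
    using assms(3) by (auto simp: fillings_def intro!: monoD[OF assms(2)])
  then have "card (fillings k m (\<lambda>i. lo (Suc i)) (\<lambda>i. up (Suc i))) > 0"
    using finite_fillings by (auto simp: card_gt_0_iff)
  then have "ps_polytope k m (\<lambda>i. real (lo i)) (\<lambda>i. real (up i)) \<inter> integer_lattice \<noteq> {}"
    unfolding card_ps_lattice[OF assms(1), symmetric] by (auto simp: card_gt_0_iff)
  then show ?thesis by blast
qed

lemma mono_partial_sum: "mono (partial_sum y)"
  by (rule monoI) (auto simp: partial_sum_def intro!: sum_mono2)

theorem theorem3p2:
  fixes k m :: nat and y z :: "nat \<Rightarrow> nat"
  assumes "k \<ge> 1" and "m \<ge> 1"
  shows "ehrhart_positive (pitman_stanley k m y z)"
proof -
  define lo up where "lo = partial_sum z" and "up = partial_sum y"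
  have Q: "pitman_stanley k m y z = ps_polytope k m (\<lambda>i. real (lo i)) (\<lambda>i. real (up i))"
    unfolding pitman_stanley_ps lo_def up_def ..
  have "lattice_polytope (pitman_stanley k m y z)"
    unfolding Q using lattice_polytope_ps[OF assms(2), of k "\<lambda>i. int (lo i)" "\<lambda>i. int (up i)"] by simp
  moreover have "\<exists>E. ehrhart_polynomial (pitman_stanley k m y z) E \<and> (\<forall>d. 0 \<le> coeff E d)"
  proof (cases "\<forall>i\<in>{1..k}. lo i \<le> up i")
    case False
    then obtain i where "i \<in> {1..k}" "up i < lo i" by (auto simp: not_le)
    then have "pitman_stanley k m y z = {}"
      unfolding Q using assms(2) by (intro ps_empty[of m i]) auto
    then show ?thesis by (intro exI[of _ 0]) (simp add: ehrhart_polynomial_def)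
  next
    case True
    have mono: "mono (\<lambda>i. lo (Suc i))" "mono (\<lambda>i. up (Suc i))"
      using mono_partial_sum by (auto simp: lo_def up_def mono_def)
    obtain E where E: "\<And>n. poly E (real n)
        = real (card (fillings k m (\<lambda>i. n * lo (Suc i)) (\<lambda>i. n * up (Suc i))))" "\<And>d. 0 \<le> coeff E d"
      using fillings_ehrhart[OF mono, of k m] True by auto
    have nonempty: "ps_polytope k m (\<lambda>i. real (lo i)) (\<lambda>i. real (up i)) \<noteq> {}"
      using ps_nonempty[OF assms(2), of up k lo] True mono_partial_sum by (auto simp: up_def)
    have "poly E (real n) = real (card ((\<lambda>x. real n *\<^sub>R x) ` pitman_stanley k m y z \<inter> integer_lattice))" for n
    proof -
      have "(\<lambda>x. real n *\<^sub>R x) ` pitman_stanley k m y z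
          = ps_polytope k m (\<lambda>i. real (n * lo i)) (\<lambda>i. real (n * up i))"
        unfolding Q using nonempty by (simp add: scale_ps[OF _ assms(2)])
      then show ?thesis
        using card_ps_lattice[OF assms(2), of k "\<lambda>i. n * lo i" "\<lambda>i. n * up i"] E(1)[of n] by simp
    qed
    then show ?thesis using E(2) unfolding ehrhart_polynomial_def by blast
  qed
  ultimately show ?thesis by (simp add: ehrhart_positive_def)
qed

end
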